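(* Let $d \in \mathbb{N}$, $a \in \mathbb{R}$, $b \in (a,\infty)$, let $(\Omega,\mathcal{F},\mathbb{P})$ be a probability space, and let $X_{n,m}\colon \Omega \to [a,b]^d$, $(n,m) \in \mathbb{Z}^2$, be i.i.d. random variables such that for all $x \in [a,b]^d$ and all $\varepsilon \in (0,1)$ it holds that $\mathbb{P}(\|X_{0,0}-x\| < \varepsilon) > 0$. Let $\mathfrak{l}\colon \mathbb{R}^d\times\mathbb{R}^d\to\mathbb{R}$ satisfy $\mathfrak{l}(\theta,x) = \|\theta - x\|^2$ for all $\theta,x\in\mathbb{R}^d$. Let $M,\mathfrak{M}\in\mathbb{N}$ and let $\Theta\colon \mathbb{N}_0\times\Omega\to\mathbb{R}^d$ and $\gamma\colon\mathbb{N}\times\Omega\to\mathbb{R}$ be stochastic processes such that for all $n\in\mathbb{N}$ $$\Theta_n = \Theta_{n-1} - \frac{\gamma_n}{M}\Big[\sum_{m=1}^M (\nabla_\theta \mathfrak{l})(\Theta_{n-1}, X_{n,m})\Big].$$ Assume that $(X_{n,m})_{(n,m)\in\mathbb{Z}^2}$ and $\Theta_0$ are independent and that $\mathbb{E}[\|\Theta_0\|^2]<\infty$. Let $(\nu_n)_{n\in\mathbb{N}}\subseteq(0,1)$ be strictly decreasing with $\sum_{n=1}^\infty \nu_n = \infty$ and $\limsup_{n\to\infty}\nu_n = 0$. Assume $\gamma_1 = \nu_1$ and for all $n\in\mathbb{N}$ $$\gamma_{n+1} = \begin{cases} \gamma_n & \text{if } \sum_{m=1}^{\mathfrak{M}}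 \mathfrak{l}(\Theta_n, X_{n,-m}) \le \sum_{m=1}^{\mathfrak{M}} \mathfrak{l}(\Theta_{n-1}, X_{n,-m}),\\ \max\big((0,\gamma_n)\cap \{\nu_k\colon k\in\mathbb{N}\}\big) & \text{if } \sum_{m=1}^{\mathfrak{M}} \mathfrak{l}(\Theta_n, X_{n,-m}) > \sum_{m=1}^{\mathfrak{M}} \mathfrak{l}(\Theta_{n-1}, X_{n,-m}).\end{cases}$$ For every $t\in[0,\infty)$ let $N_t = \inf\{n\in\mathbb{N}_0\colon \sum_{k=1}^n \gamma_k \ge t\}$. Then $$\limsup_{t\to\infty}\mathbb{E}\big[\|\Theta_{N_t} - \mathbb{E}[X_{1,1}]\|\big] = 0.$$
   Context: $\|\cdot\|$ denotes the Euclidean norm; $\nabla_\theta\mathfrak{l}$ is the gradient with respect to the first argument. *)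

theory Defs
  imports "HOL-Probability.Probability"
begin

definition grad1 :: "('v::real_inner \<Rightarrow> 'v \<Rightarrow> real) \<Rightarrow> 'v \<Rightarrow> 'v \<Rightarrow> 'v" where
  "grad1 f \<theta> x = (THE g. ((\<lambda>t. f t x) has_derivative (\<lambda>h. g \<bullet> h)) (at \<theta>))"

end

theory Submission
  imports Defs
begin

text \<open>
  Write \<open>D\<^sub>n = \<Theta>\<^sub>n - E[X\<^sub>1\<^sub>1]\<close>. Since all step sizes are at most \<open>\<nu>\<^sub>1 < 1\<close>, the path \<open>\<parallel>D\<^sub>n\<parallel>\<close> stays below a
  square integrable variable \<open>B\<close>.

  The step sizes tend to \<open>0\<close> almost surely: as long as the step size is at least \<open>\<nu>\<^sub>k\<close>, the test loss
  increases at most \<open>k\<close> times, each time by at most a multiple of \<open>B\<^sup>2\<close>. The expected increments of the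
  test loss are multiples of those of \<open>\<parallel>D\<^sub>n\<parallel>\<^sup>2\<close>, which telescope, so the expected sum of their absolute
  values is finite. On the other hand the test loss moves by an amount bounded away from \<open>0\<close> in mean at
  each such time, because an affine functional of one sample that is independent of everything else
  cannot concentrate at a point. Hence the expected time spent at step sizes \<open>\<ge> \<nu>\<^sub>k\<close> is finite.

  Convergence then follows from the pathwise recursion for \<open>exp (c T\<^sub>n) \<parallel>D\<^sub>n\<parallel>\<^sup>2\<close>, where
  \<open>T\<^sub>n = \<gamma>\<^sub>1 + \<dots> + \<gamma>\<^sub>n\<close>, summed up to \<open>N\<^sub>t\<close>: the cross terms have mean \<open>0\<close>, and the remaining sum
  \<open>exp (- c t) \<Sum> exp (c T\<^sub>n) \<gamma>\<^sub>n\<^sup>2\<close> is bounded and tends to \<open>0\<close> almost surely with the step sizes.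
  As \<open>\<gamma>\<^sub>n \<ge> \<nu>\<^sub>n\<close>, the time \<open>N\<^sub>t\<close> is bounded by a deterministic one, so all sums are finite.
\<close>

section \<open>Gradient of the squared distance\<close>

lemma grad1_eq:
  fixes f :: "'v::real_inner \<Rightarrow> 'v \<Rightarrow> real"
  assumes "((\<lambda>t. f t x) has_derivative (\<lambda>h. g \<bullet> h)) (at \<theta>)"
  shows "grad1 f \<theta> x = g"
  unfolding grad1_def
proof (rule the_equality)
  fix g' assume "((\<lambda>t. f t x) has_derivative (\<lambda>h. g' \<bullet> h)) (at \<theta>)"
  then have "(\<lambda>h. g' \<bullet> h) = (\<lambda>h. g \<bullet> h)"
    using assms by (rule has_derivative_unique)
  then have "g' \<bullet> h = g \<bullet> h" for h
    by (rule fun_cong)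
  then show "g' = g"
    by (metis vector_eq_rdot)
qed (fact assms)

lemma grad1_squared_dist:
  fixes l :: "'v::real_inner \<Rightarrow> 'v \<Rightarrow> real"
  assumes "\<And>\<theta> x. l \<theta> x = (norm (\<theta> - x))\<^sup>2"
  shows "grad1 l \<theta> x = 2 *\<^sub>R (\<theta> - x)"
proof (rule grad1_eq)
  show "((\<lambda>t. l t x) has_derivative (\<lambda>h. (2 *\<^sub>R (\<theta> - x)) \<bullet> h)) (at \<theta>)"
    unfolding assms power2_norm_eq_inner
    by (auto intro!: derivative_eq_intros simp: inner_commute)
qed

section \<open>Independence\<close>

text \<open>Adjoining \<open>Z\<close> under the index \<open>None\<close> merges two separate
  independence assumptions into one independent family. A finite intersection of
  \<open>Y\<close>-events lies in the sigma-algebra generated by \<open>Y\<close>, so the event of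
  \<open>Z\<close> factors off, and independence of \<open>Y\<close> splits the rest.\<close>

lemma (in prob_space) indep_vars_case_option:
  fixes Y :: "'i \<Rightarrow> 'a \<Rightarrow> 'b"
  assumes Y: "indep_vars (\<lambda>_. N) Y UNIV"
    and Z: "Z \<in> measurable M N"
    and ind: "indep_set (sigma_sets (space M) (\<Union>i. {Y i -` A \<inter> space M |A. A \<in> sets N}))
        (sigma_sets (space M) {Z -` A \<inter> space M |A. A \<in> sets N})"
  shows "indep_vars (\<lambda>_. N) (case_option Z Y) UNIV"
  unfolding indep_vars_def2
proof safe
  show "case_option Z Y i \<in> measurable M N" for i
    using Z Y by (auto simp: indep_vars_def2 split: option.split)
  let ?F = "\<lambda>i. {case_option Z Y i -` A \<inter> space M |A. A \<in> sets N}"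
  have Ym: "Y i \<in> measurable M N" for i
    using Y by (auto simp: indep_vars_def2)
  have IY: "indep_sets (\<lambda>i. {Y i -` A \<inter> space M |A. A \<in> sets N}) UNIV"
    using Y by (auto simp: indep_vars_def2)
  show "indep_sets ?F UNIV"
  proof (rule indep_setsI)
    fix i :: "'i option"
    show "?F i \<subseteq> events"
      using Ym Z by (cases i) (auto intro!: measurable_sets)
  next
    fix A and J :: "'i option set"
    assume J: "J \<noteq> {}" "J \<subseteq> UNIV" "finite J" "\<forall>j\<in>J. A j \<in> ?F j"
    define K where "K = {i. Some i \<in> J}"
    have JK: "J - {None} = Some ` K"
      unfolding K_def by (auto simp: image_iff) (metis not_None_eq)
    have finK: "finite K"
      using J(3) by (metis JK finite_Diff finite_imageD inj_Some)
    have AK: "\<forall>i\<in>K. A (Some i) \<in> {Y i -` A \<inter> space M |A. A \<in> sets N}"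
      using J(4) by (force simp: K_def)
    have prodK: "prob (\<Inter>i\<in>K. A (Some i)) = (\<Prod>i\<in>K. prob (A (Some i)))" if "K \<noteq> {}"
      by (rule indep_setsD[OF IY _ that finK AK]) simp
    show "prob (\<Inter>j\<in>J. A j) = (\<Prod>j\<in>J. prob (A j))"
    proof (cases "None \<in> J")
      case False
      then have "J = Some ` K" using JK by auto
      then show ?thesis
        using prodK J(1) by (simp add: prod.reindex)
    next
      case True
      then have J_eq: "J = insert None (Some ` K)" using JK by auto
      show ?thesis
      proof (cases "K = {}")
        case True
        then show ?thesis using J_eq by simp
      next
        case False
        let ?G = "\<Union>i. {Y i -` A \<inter> space M |A. A \<in> sets N}"
        have G: "sets (sigma (space M) ?G) = sigma_sets (space M) ?G"
          by (rule sets_measure_of) auto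
        have "(\<Inter>i\<in>K. A (Some i)) \<in> sets (sigma (space M) ?G)"
          using AK finK False by (intro sets.finite_INT) (auto simp: G intro!: sigma_sets.Basic)
        moreover have "A None \<in> sigma_sets (space M) {Z -` A \<inter> space M |A. A \<in> sets N}"
          using J(4) True by force
        ultimately have "prob ((\<Inter>i\<in>K. A (Some i)) \<inter> A None) = prob (\<Inter>i\<in>K. A (Some i)) * prob (A None)"
          using indep_setD[OF ind] unfolding G by blast
        then show ?thesis
          using prodK[OF False] J_eq finK by (simp add: prod.reindex Int_commute mult.commute)
      qed
    qed
  qed
qed

text \<open>The sigma-algebra generated by all variables except \<open>Y i\<close>, packaged as a
  measure so that depending on these variables only becomes a measurability statement.\<close>

definition (in prob_space) others :: "'b measure \<Rightarrow> ('i \<Rightarrow> 'a \<Rightarrow> 'b) \<Rightarrow> 'i \<Rightarrow> 'a measure" where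
  "others N Y i = sigma (space M) (\<Union>j\<in>- {i}. {Y j -` A \<inter> space M |A. A \<in> sets N})"

lemma (in prob_space) space_others [simp]: "space (others N Y i) = space M"
  by (simp add: others_def space_measure_of_conv)

lemma (in prob_space) sets_others:
  "sets (others N Y i) = sigma_sets (space M) (\<Union>j\<in>- {i}. {Y j -` A \<inter> space M |A. A \<in> sets N})"
  unfolding others_def by (rule sets_measure_of) auto

lemma (in prob_space) measurable_others:
  assumes "Y j \<in> measurable M N" "j \<noteq> i"
  shows "Y j \<in> measurable (others N Y i) N"
proof (rule measurableI)
  show "x \<in> space (others N Y i) \<Longrightarrow> Y j x \<in> space N" for x
    using measurable_space[OF assms(1)] by simp
  show "A \<in> sets N \<Longrightarrow> Y j -` A \<inter> space (others N Y i) \<in> sets (others N Y i)" for A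
    unfolding sets_others space_others using assms(2) by (intro sigma_sets.Basic) auto
qed

text \<open>Blocks of an independent family over disjoint index sets, here \<open>{i}\<close> and
  its complement, generate independent sigma-algebras, because the generating classes are closed
  under intersection.\<close>

lemma (in prob_space) indep_set_others:
  assumes "indep_vars (\<lambda>_. N) Y UNIV"
  shows "indep_set {Y i -` A \<inter> space M |A. A \<in> sets N} (sets (others N Y i))"
proof -
  let ?E = "\<lambda>j. {Y j -` A \<inter> space M |A. A \<in> sets N}"
  let ?I = "\<lambda>c. if c then {i} else - {i}"
  have "indep_sets ?E (\<Union>c\<in>UNIV. ?I c)"
    using assms by (simp add: indep_vars_def2 UNIV_bool insert_UNIV Un_commute Compl_partition2)
  then have "indep_sets (\<lambda>c. sigma_sets (space M) (\<Union>j\<in>?I c. ?E j)) UNIV"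
  proof (rule indep_sets_collect_sigma)
    show "Int_stable (?E j)" for j
      unfolding Int_stable_def
    proof safe
      fix A B assume "A \<in> sets N" "B \<in> sets N"
      then show "\<exists>C. Y j -` A \<inter> space M \<inter> (Y j -` B \<inter> space M) = Y j -` C \<inter> space M \<and> C \<in> sets N"
        by (intro exI[of _ "A \<inter> B"]) auto
    qed
  qed (auto simp: disjoint_family_on_def)
  then show ?thesis
    unfolding indep_set_def
    by (rule indep_sets_mono_sets) (auto simp: sets_others split: bool.split)
qed

context prob_space
begin

context
  fixes S :: "'b measure" and T :: "'u measure" and H :: "'a measure" and Y U
  assumes ind: "indep_set {Y -` A \<inter> space M |A. A \<in> sets S} (sets H)"
    and H: "space H = space M"
    and Y: "Y \<in> measurable M S"
    and UH: "U \<in> measurable H T"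
begin

lemma measurable_indep_algebra: "U \<in> measurable M T"
proof (rule measurableI)
  show "x \<in> space M \<Longrightarrow> U x \<in> space T" for x
    using measurable_space[OF UH] H by simp
  show "A \<in> sets T \<Longrightarrow> U -` A \<inter> space M \<in> sets M" for A
    using measurable_sets[OF UH, of A] ind H by (auto simp: indep_sets2_eq)
qed

text \<open>Since \<open>U\<close> is measurable for the algebra \<open>H\<close>, it is independent
  of \<open>Y\<close>. Hence both measures agree on rectangles, which determine the product
  measure.\<close>

lemma distr_pair_indep:
  "distr M T U \<Otimes>\<^sub>M distr M S Y = distr M (T \<Otimes>\<^sub>M S) (\<lambda>\<omega>. (U \<omega>, Y \<omega>))"
proof (rule pair_measure_eqI)
  note Y[measurable] measurable_indep_algebra[measurable]
  interpret DU: prob_space "distr M T U" by (rule prob_space_distr) measurable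
  interpret DY: prob_space "distr M S Y" by (rule prob_space_distr) measurable
  show "sigma_finite_measure (distr M T U)" "sigma_finite_measure (distr M S Y)"
    by unfold_locales
  show "sets (distr M T U \<Otimes>\<^sub>M distr M S Y) = sets (distr M (T \<Otimes>\<^sub>M S) (\<lambda>\<omega>. (U \<omega>, Y \<omega>)))"
    by (simp cong: sets_pair_measure_cong)
  fix A B assume "A \<in> sets (distr M T U)" "B \<in> sets (distr M S Y)"
  then have AB[measurable]: "A \<in> sets T" "B \<in> sets S" by auto
  have "prob ((Y -` B \<inter> space M) \<inter> (U -` A \<inter> space M)) =
      prob (Y -` B \<inter> space M) * prob (U -` A \<inter> space M)"
    using measurable_sets[OF UH AB(1)] AB(2) H by (intro indep_setD[OF ind]) auto
  moreover have "(\<lambda>\<omega>. (U \<omega>, Y \<omega>)) -` (A \<times> B) \<inter> space M =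
      (Y -` B \<inter> space M) \<inter> (U -` A \<inter> space M)"
    by auto
  ultimately show "emeasure (distr M T U) A * emeasure (distr M S Y) B =
      emeasure (distr M (T \<Otimes>\<^sub>M S) (\<lambda>\<omega>. (U \<omega>, Y \<omega>))) (A \<times> B)"
    by (simp add: emeasure_distr emeasure_eq_measure ennreal_mult' mult.commute)
qed

text \<open>Freezing: the joint law is a product, so Tonelli allows integrating over
  \<open>Y\<close> first with the value of \<open>U\<close> held fixed. A lower bound for every
  deterministic \<open>u\<close> thus survives the substitution of \<open>U\<close>.\<close>

lemma nn_integral_indep_ge:
  assumes f[measurable]: "case_prod f \<in> borel_measurable (T \<Otimes>\<^sub>M S)"
    and h: "\<And>u. u \<in> space T \<Longrightarrow> h u \<le> (\<integral>\<^sup>+\<omega>. f u (Y \<omega>) \<partial>M)"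
  shows "(\<integral>\<^sup>+\<omega>. h (U \<omega>) \<partial>M) \<le> (\<integral>\<^sup>+\<omega>. f (U \<omega>) (Y \<omega>) \<partial>M)"
proof -
  note Y[measurable] measurable_indep_algebra[measurable]
  interpret DY: prob_space "distr M S Y" by (rule prob_space_distr) measurable
  have "(\<integral>\<^sup>+\<omega>. h (U \<omega>) \<partial>M) \<le> (\<integral>\<^sup>+\<omega>. (\<integral>\<^sup>+\<omega>'. f (U \<omega>) (Y \<omega>') \<partial>M) \<partial>M)"
    using measurable_space[OF measurable_indep_algebra] by (intro nn_integral_mono h)
  also have "\<dots> = (\<integral>\<^sup>+\<omega>. (\<integral>\<^sup>+y. f (U \<omega>) y \<partial>distr M S Y) \<partial>M)"
  proof (rule nn_integral_cong)
    fix \<omega> assume "\<omega> \<in> space M"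
    then have "U \<omega> \<in> space T"
      using measurable_space[OF measurable_indep_algebra] by auto
    then have "f (U \<omega>) \<in> borel_measurable S"
      using measurable_Pair2[OF f] by simp
    then show "(\<integral>\<^sup>+\<omega>'. f (U \<omega>) (Y \<omega>') \<partial>M) = (\<integral>\<^sup>+y. f (U \<omega>) y \<partial>distr M S Y)"
      by (subst nn_integral_distr) auto
  qed
  also have "\<dots> = (\<integral>\<^sup>+u. (\<integral>\<^sup>+y. f u y \<partial>distr M S Y) \<partial>distr M T U)"
    by (subst nn_integral_distr) (auto intro!: DY.borel_measurable_nn_integral)
  also have "\<dots> = (\<integral>\<^sup>+z. case_prod f z \<partial>(distr M T U \<Otimes>\<^sub>M distr M S Y))"
    by (subst DY.nn_integral_fst[symmetric]) auto
  also have "\<dots> = (\<integral>\<^sup>+\<omega>. f (U \<omega>) (Y \<omega>) \<partial>M)"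
    unfolding distr_pair_indep by (subst nn_integral_distr) auto
  finally show ?thesis .
qed

end

lemma indep_var_indep_algebra:
  assumes "indep_set {Y -` A \<inter> space M |A. A \<in> sets N} (sets H)" "space H = space M"
    "Y \<in> measurable M N" "U \<in> measurable H N"
  shows "indep_var N U N Y"
  using measurable_indep_algebra[OF assms] distr_pair_indep[OF assms] assms(3)
  by (simp add: indep_var_distribution_eq)

text \<open>Coordinatewise this is the product rule for independent integrable real
  variables.\<close>

lemma expectation_inner_indep:
  fixes Y U :: "'a \<Rightarrow> 'b::euclidean_space"
  assumes ind: "indep_set {Y -` A \<inter> space M |A. A \<in> sets borel} (sets H)"
    and H: "space H = space M"
    and Y: "integrable M Y" and U: "integrable M U" and UH: "U \<in> borel_measurable H"
  shows "integrable M (\<lambda>\<omega>. U \<omega> \<bullet> Y \<omega>)"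
    and "expectation (\<lambda>\<omega>. U \<omega> \<bullet> Y \<omega>) = expectation U \<bullet> expectation Y"
proof -
  have iv: "indep_var borel U borel Y"
    by (rule indep_var_indep_algebra[OF ind H _ UH]) (use Y in measurable)
  have ivb: "indep_var borel (\<lambda>\<omega>. U \<omega> \<bullet> b) borel (\<lambda>\<omega>. Y \<omega> \<bullet> b)" for b
    using indep_var_compose[OF iv, of "\<lambda>x. x \<bullet> b" borel "\<lambda>x. x \<bullet> b" borel] by (simp add: comp_def)
  have int: "integrable M (\<lambda>\<omega>. U \<omega> \<bullet> b * (Y \<omega> \<bullet> b))" for b
    using U Y by (intro indep_var_integrable ivb) auto
  then show "integrable M (\<lambda>\<omega>. U \<omega> \<bullet> Y \<omega>)"
    by (subst euclidean_inner) auto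
  have "expectation (\<lambda>\<omega>. U \<omega> \<bullet> Y \<omega>) = (\<Sum>b\<in>Basis. expectation (\<lambda>\<omega>. U \<omega> \<bullet> b * (Y \<omega> \<bullet> b)))"
    using int by (subst euclidean_inner) (simp add: Bochner_Integration.integral_sum)
  also have "\<dots> = (\<Sum>b\<in>Basis. expectation (\<lambda>\<omega>. U \<omega> \<bullet> b) * expectation (\<lambda>\<omega>. Y \<omega> \<bullet> b))"
    using U Y by (intro sum.cong refl indep_var_lebesgue_integral ivb) auto
  also have "\<dots> = expectation U \<bullet> expectation Y"
    using U Y by (subst euclidean_inner) (simp)
  finally show "expectation (\<lambda>\<omega>. U \<omega> \<bullet> Y \<omega>) = expectation U \<bullet> expectation Y" .
qed

end

text \<open>
  At least one of the two corners of the box that maximize and minimize \<open>v \<bullet> x\<close> is far from the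
  hyperplane \<open>v \<bullet> x = r\<close>, and each of the finitely many corners has a neighbourhood of positive mass.
\<close>

lemma (in prob_space) nn_integral_affine_ge:
  fixes Y :: "'a \<Rightarrow> real ^ 'd"
  assumes "a < b" and Y[measurable]: "Y \<in> borel_measurable M"
    and supp: "\<And>x \<epsilon>. (\<forall>i. a \<le> x $ i \<and> x $ i \<le> b) \<Longrightarrow> 0 < \<epsilon> \<Longrightarrow> \<epsilon> < 1 \<Longrightarrow>
        prob {\<omega> \<in> space M. norm (Y \<omega> - x) < \<epsilon>} > 0"
  obtains c where "0 < c" "\<And>v r. ennreal (c * norm v) \<le> (\<integral>\<^sup>+\<omega>. ennreal \<bar>r - v \<bullet> Y \<omega>\<bar> \<partial>M)"
proof -
  define corner :: "'d set \<Rightarrow> real ^ 'd" where "corner = (\<lambda>S. \<chi> i. if i \<in> S then b else a)"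
  \<comment> \<open>Within distance \<open>(b - a) / 4\<close> of the far corner the functional
    loses at most half of the guaranteed \<open>(b - a) / 2 * norm v\<close>. The cap 1/2 meets the
    condition \<open>\<epsilon> < 1\<close> of \<open>supp\<close>.\<close>
  define \<epsilon> where "\<epsilon> = min (1/2) ((b - a) / 4)"
  define E where "E = (\<lambda>S. {\<omega> \<in> space M. norm (Y \<omega> - corner S) < \<epsilon>})"
  define p where "p = Min (range (\<lambda>S. prob (E S)))"
  have \<epsilon>: "0 < \<epsilon>" "\<epsilon> < 1" "\<epsilon> \<le> (b - a) / 4"
    using \<open>a < b\<close> by (auto simp: \<epsilon>_def min_def)
  have E[measurable]: "E S \<in> sets M" for S
    unfolding E_def by measurable
  have "0 < prob (E S)" for S
    unfolding E_def using \<open>a < b\<close> \<epsilon> by (intro supp) (auto simp: corner_def)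
  then have p: "0 < p"
    unfolding p_def by (subst Min_gr_iff) auto
  have p_le: "p \<le> prob (E S)" for S
    unfolding p_def by (intro Min_le) auto
  show ?thesis
  proof
    show "0 < p * (b - a) / 4"
      using p \<open>a < b\<close> by simp
    fix v :: "real ^ 'd" and r :: real
    \<comment> \<open>The corner of \<open>S\<close> maximizes \<open>v \<bullet> x\<close> over the
      box and that of \<open>- S\<close> minimizes it. Their values differ by \<open>b - a\<close>
      times the l1 norm of \<open>v\<close>, so one of them is at least half of that away from
      \<open>r\<close>.\<close>
    define S where "S = {i. 0 \<le> v $ i}"
    have "(b - a) * norm v \<le> (b - a) * (\<Sum>i\<in>UNIV. \<bar>v $ i\<bar>)"
      using \<open>a < b\<close> by (intro mult_left_mono norm_le_l1_cart) auto
    also have "\<dots> = v \<bullet> corner S - v \<bullet> corner (- S)"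
      unfolding inner_vec_def corner_def sum_distrib_left sum_subtractf[symmetric]
      by (intro sum.cong) (auto simp: S_def algebra_simps)
    finally have "(b - a) * norm v \<le> v \<bullet> corner S - v \<bullet> corner (- S)" .
    then have "(b - a) * norm v / 2 \<le> \<bar>r - v \<bullet> corner S\<bar> \<or>
        (b - a) * norm v / 2 \<le> \<bar>r - v \<bullet> corner (- S)\<bar>"
      by linarith
    then obtain Q where Q: "(b - a) / 2 * norm v \<le> \<bar>r - v \<bullet> corner Q\<bar>"
      by auto
    have "(b - a) / 4 * norm v \<le> \<bar>r - v \<bullet> Y \<omega>\<bar>" if "\<omega> \<in> E Q" for \<omega>
    proof -
      have "\<bar>v \<bullet> (Y \<omega> - corner Q)\<bar> \<le> norm v * norm (Y \<omega> - corner Q)"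
        by (rule Cauchy_Schwarz_ineq2)
      also have "\<dots> \<le> norm v * ((b - a) / 4)"
        using that \<epsilon> by (intro mult_left_mono) (auto simp: E_def)
      finally show ?thesis
        using Q by (simp add: inner_diff_right algebra_simps abs_if split: if_splits)
    qed
    then have "(\<integral>\<^sup>+\<omega>. ennreal ((b - a) / 4 * norm v) * indicator (E Q) \<omega> \<partial>M)
        \<le> (\<integral>\<^sup>+\<omega>. ennreal \<bar>r - v \<bullet> Y \<omega>\<bar> \<partial>M)"
      by (intro nn_integral_mono) (auto split: split_indicator)
    moreover have "ennreal (p * (b - a) / 4 * norm v) \<le> ennreal ((b - a) / 4 * norm v) * ennreal (prob (E Q))"
      using mult_right_mono[OF p_le[of Q], of "(b - a) / 4 * norm v"] \<open>a < b\<close>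
      unfolding ennreal_mult''[OF measure_nonneg, symmetric]
      by (intro ennreal_leI) (simp add: mult.commute mult.left_commute)
    ultimately show "ennreal (p * (b - a) / 4 * norm v) \<le> (\<integral>\<^sup>+\<omega>. ennreal \<bar>r - v \<bullet> Y \<omega>\<bar> \<partial>M)"
      by (simp only: nn_integral_cmult_indicator[OF E] emeasure_eq_measure)
  qed
qed

section \<open>The adaptive scheme\<close>

text \<open>The setting of the theorem with the gradient evaluated, the loss written out and the
  recursions shifted to \<open>Suc\<close>. A gradient step becomes a move relative to the batch
  mean.\<close>

locale adaptive_sgd = prob_space M for M :: "'w measure" +
  fixes X :: "int \<Rightarrow> int \<Rightarrow> 'w \<Rightarrow> real ^ 'd"
    and a b :: real
    and Mb Mf :: nat
    and \<Theta> :: "nat \<Rightarrow> 'w \<Rightarrow> real ^ 'd"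
    and \<gamma> :: "nat \<Rightarrow> 'w \<Rightarrow> real"
    and \<nu> :: "nat \<Rightarrow> real"
  assumes a_less_b: "a < b"
    and X_meas[measurable]: "\<And>n m. X n m \<in> borel_measurable M"
    and X_range: "\<And>n m \<omega> i. \<omega> \<in> space M \<Longrightarrow> a \<le> X n m \<omega> $ i \<and> X n m \<omega> $ i \<le> b"
    and X_indep: "indep_vars (\<lambda>_. borel) (\<lambda>p. X (fst p) (snd p)) UNIV"
    and X_ident: "\<And>n m. distr M borel (X n m) = distr M borel (X 0 0)"
    and X_supp: "\<And>x \<epsilon>. (\<forall>i. a \<le> x $ i \<and> x $ i \<le> b) \<Longrightarrow> 0 < \<epsilon> \<Longrightarrow> \<epsilon> < 1 \<Longrightarrow>
        prob {\<omega> \<in> space M. norm (X 0 0 \<omega> - x) < \<epsilon>} > 0"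
    and Mb: "Mb \<ge> 1" and Mf: "Mf \<ge> 1"
    and \<Theta>_0_meas[measurable]: "\<Theta> 0 \<in> borel_measurable M"
    and \<Theta>_Suc: "\<And>n \<omega>. \<omega> \<in> space M \<Longrightarrow> \<Theta> (Suc n) \<omega> = \<Theta> n \<omega> - (2 * \<gamma> (Suc n) \<omega>) *\<^sub>R
        (\<Theta> n \<omega> - (1 / real Mb) *\<^sub>R (\<Sum>m = 1..Mb. X (int (Suc n)) (int m) \<omega>))"
    and indep_X_\<Theta>0: "indep_set
        (sigma_sets (space M) (\<Union>p. {X (fst p) (snd p) -` A \<inter> space M | A. A \<in> sets borel}))
        (sigma_sets (space M) {\<Theta> 0 -` A \<inter> space M | A. A \<in> sets borel})"
    and \<Theta>_0_L2: "integrable M (\<lambda>\<omega>. (norm (\<Theta> 0 \<omega>))\<^sup>2)"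
    and \<nu>_range: "\<And>n. n \<ge> 1 \<Longrightarrow> 0 < \<nu> n \<and> \<nu> n < 1"
    and \<nu>_decr: "\<And>n k. 1 \<le> n \<Longrightarrow> n < k \<Longrightarrow> \<nu> k < \<nu> n"
    and \<nu>_div: "filterlim (\<lambda>K. \<Sum>n = 1..K. \<nu> n) at_top sequentially"
    and \<nu>_lim: "\<nu> \<longlonglongrightarrow> 0"
    and \<gamma>_1: "\<And>\<omega>. \<omega> \<in> space M \<Longrightarrow> \<gamma> 1 \<omega> = \<nu> 1"
    and \<gamma>_Suc: "\<And>n \<omega>. \<omega> \<in> space M \<Longrightarrow> \<gamma> (Suc (Suc n)) \<omega> =
          (if (\<Sum>m = 1..Mf. (norm (\<Theta> (Suc n) \<omega> - X (int (Suc n)) (- int m) \<omega>))\<^sup>2)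
                \<le> (\<Sum>m = 1..Mf. (norm (\<Theta> n \<omega> - X (int (Suc n)) (- int m) \<omega>))\<^sup>2)
           then \<gamma> (Suc n) \<omega>
           else (GREATEST y. y \<in> {0<..<\<gamma> (Suc n) \<omega>} \<inter> {\<nu> k | k. k \<ge> 1}))"
begin

section \<open>Centred iterates and the counter of loss increases\<close>

definition \<mu> where "\<mu> = expectation (X 1 1)"

definition D where "D n \<omega> = \<Theta> n \<omega> - \<mu>"

text \<open>Indexed by the time at which the step starts: \<open>noise n\<close> and \<open>incr n\<close> use the samples \<open>X (n + 1)\<close>.\<close>

definition noise where
  "noise n \<omega> = (1 / real Mb) *\<^sub>R (\<Sum>m = 1..Mb. X (int (Suc n)) (int m) \<omega>) - \<mu>"

definition incr where
  "incr n \<omega> = (\<Sum>m = 1..Mf. (norm (\<Theta> (Suc n) \<omega> - X (int (Suc n)) (- int m) \<omega>))\<^sup>2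
      - (norm (\<Theta> n \<omega> - X (int (Suc n)) (- int m) \<omega>))\<^sup>2)"

text \<open>The position in the sequence \<open>\<nu>\<close> that the step size has reached.
  Counting the loss increases so far replaces the recursive choice of the next smaller
  value.\<close>

definition \<kappa> where "\<kappa> n \<omega> = Suc (card {i. i < n \<and> 0 < incr i \<omega>})"

text \<open>This is \<open>\<gamma> (Suc n)\<close>, which leads from time \<open>n\<close> to time \<open>n + 1\<close>.\<close>

definition step where "step n \<omega> = \<nu> (\<kappa> n \<omega>)"

lemma \<kappa>_ge_1: "1 \<le> \<kappa> n \<omega>"
  by (simp add: \<kappa>_def)

lemma \<kappa>_0 [simp]: "\<kappa> 0 \<omega> = 1"
  by (simp add: \<kappa>_def)

lemma \<kappa>_Suc: "\<kappa> (Suc n) \<omega> = (if 0 < incr n \<omega> then Suc (\<kappa> n \<omega>) else \<kappa> n \<omega>)"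
proof -
  have "{i. i < Suc n \<and> 0 < incr i \<omega>} =
      (if 0 < incr n \<omega> then insert n {i. i < n \<and> 0 < incr i \<omega>} else {i. i < n \<and> 0 < incr i \<omega>})"
    by (auto simp: less_Suc_eq)
  then show ?thesis
    by (auto simp: \<kappa>_def)
qed

lemma \<kappa>_mono: "m \<le> n \<Longrightarrow> \<kappa> m \<omega> \<le> \<kappa> n \<omega>"
  by (rule lift_Suc_mono_le[of "\<lambda>n. \<kappa> n \<omega>"]) (auto simp: \<kappa>_Suc)

lemma \<kappa>_le: "\<kappa> n \<omega> \<le> Suc n"
  by (induction n) (auto simp: \<kappa>_Suc)

lemma \<nu>_antimono: "1 \<le> i \<Longrightarrow> i \<le> j \<Longrightarrow> \<nu> j \<le> \<nu> i"
  using \<nu>_decr[of i j] by (cases "i = j") auto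

lemma step_pos: "0 < step n \<omega>" and step_le: "step n \<omega> \<le> \<nu> 1" and step_ge: "\<nu> (Suc n) \<le> step n \<omega>"
  unfolding step_def using \<nu>_range \<kappa>_ge_1 \<nu>_antimono \<kappa>_le by auto

lemma \<nu>_1: "0 < \<nu> 1" "\<nu> 1 < 1"
  using \<nu>_range by auto

text \<open>As \<open>\<nu>\<close> is strictly decreasing, every value below \<open>\<nu> k\<close>
  has an index beyond \<open>k\<close>.\<close>

lemma Greatest_\<nu>:
  assumes "1 \<le> k"
  shows "(GREATEST y. y \<in> {0<..<\<nu> k} \<inter> {\<nu> j | j. j \<ge> 1}) = \<nu> (Suc k)"
proof (rule Greatest_equality)
  show "\<nu> (Suc k) \<in> {0<..<\<nu> k} \<inter> {\<nu> j |j. 1 \<le> j}"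
    using assms \<nu>_range \<nu>_decr[of k "Suc k"] by auto
  fix y assume "y \<in> {0<..<\<nu> k} \<inter> {\<nu> j |j. 1 \<le> j}"
  then obtain j where j: "y = \<nu> j" "1 \<le> j" "\<nu> j < \<nu> k" by auto
  then have "Suc k \<le> j"
    using \<nu>_antimono[of j k] by force
  then show "y \<le> \<nu> (Suc k)"
    using j \<nu>_antimono[of "Suc k" j] by simp
qed

lemma \<gamma>_eq_step: "\<omega> \<in> space M \<Longrightarrow> \<gamma> (Suc n) \<omega> = step n \<omega>"
proof (induction n)
  case 0
  then show ?case using \<gamma>_1 by (simp add: step_def)
next
  case (Suc n)
  then show ?case
    using Greatest_\<nu>[OF \<kappa>_ge_1, of n \<omega>]
    by (simp add: \<gamma>_Suc step_def \<kappa>_Suc incr_def sum_subtractf not_le)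
qed

lemma D_Suc:
  assumes "\<omega> \<in> space M"
  shows "D (Suc n) \<omega> = (1 - 2 * step n \<omega>) *\<^sub>R D n \<omega> + (2 * step n \<omega>) *\<^sub>R noise n \<omega>"
  using assms by (simp add: D_def noise_def \<Theta>_Suc \<gamma>_eq_step algebra_simps)

section \<open>Pathwise bounds for samples and iterates\<close>

definition R where "R = 2 * (real CARD('d) * max \<bar>a\<bar> \<bar>b\<bar>)"

text \<open>The factor 2 in \<open>R\<close> leaves one half for a sample and one half for the mean,
  so that \<open>R\<close> bounds centred samples. The Euclidean norm is estimated by the l1
  norm.\<close>

lemma norm_X_le: "\<omega> \<in> space M \<Longrightarrow> norm (X n m \<omega>) \<le> R / 2"
proof -
  assume "\<omega> \<in> space M"
  then have "\<bar>X n m \<omega> $ i\<bar> \<le> max \<bar>a\<bar> \<bar>b\<bar>" for i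
    using X_range[of \<omega> n m i] by auto
  then have "(\<Sum>i\<in>UNIV. \<bar>X n m \<omega> $ i\<bar>) \<le> real CARD('d) * max \<bar>a\<bar> \<bar>b\<bar>"
    by (intro sum_bounded_above)
  then show ?thesis
    using norm_le_l1_cart[of "X n m \<omega>"] by (simp add: R_def)
qed

lemma integrable_X [simp, intro]: "integrable M (X n m)"
  by (rule integrable_const_bound[of _ "R / 2"]) (auto intro!: AE_I2 norm_X_le simp del: le_divide_eq_numeral1)

lemma expectation_X: "expectation (X n m) = \<mu>"
proof -
  have "expectation (X n m) = integral\<^sup>L (distr M borel (X n m)) (\<lambda>x. x)" for n m
    by (subst integral_distr) auto
  then show ?thesis
    unfolding \<mu>_def by (simp only: X_ident[of n m] X_ident[of 1 1])
qed

lemma norm_\<mu>_le: "norm \<mu> \<le> R / 2"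
proof -
  have "norm \<mu> \<le> expectation (\<lambda>\<omega>. norm (X 1 1 \<omega>))"
    unfolding \<mu>_def by (rule integral_norm_bound)
  also have "\<dots> \<le> R / 2"
    by (rule integral_le_const) (auto intro!: AE_I2 norm_X_le integrable_norm simp del: le_divide_eq_numeral1)
  finally show ?thesis .
qed

lemma norm_X_diff_le: "\<omega> \<in> space M \<Longrightarrow> norm (X n m \<omega> - \<mu>) \<le> R"
  using norm_X_le[of \<omega> n m] norm_\<mu>_le norm_triangle_ineq4[of "X n m \<omega>" \<mu>] by simp

lemma noise_eq: "noise n \<omega> = (1 / real Mb) *\<^sub>R (\<Sum>m = 1..Mb. X (int (Suc n)) (int m) \<omega> - \<mu>)"
  using Mb by (simp add: noise_def sum_subtractf scaleR_right_diff_distrib sum_constant_scaleR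
      del: sum_constant)

lemma norm_noise_le:
  assumes "\<omega> \<in> space M"
  shows "norm (noise n \<omega>) \<le> R"
proof -
  have "norm (\<Sum>m = 1..Mb. X (int (Suc n)) (int m) \<omega> - \<mu>) \<le> real Mb * R"
    using sum_norm_le[of "{1..Mb}" "\<lambda>m. X (int (Suc n)) (int m) \<omega> - \<mu>" "\<lambda>_. R"]
      norm_X_diff_le[OF assms] by auto
  then show ?thesis
    using Mb by (simp add: noise_eq field_simps)
qed

text \<open>The entry \<open>R / (1 - \<nu> 1)\<close> absorbs the noise even when a step size g
  above 1/2 makes the factor 1 - 2 g negative.\<close>

definition B where "B \<omega> = max (norm (D 0 \<omega>)) (R / (1 - \<nu> 1))"

lemma B_ge: "R / (1 - \<nu> 1) \<le> B \<omega>" "R \<le> (1 - \<nu> 1) * B \<omega>" "R \<le> B \<omega>" "0 \<le> B \<omega>"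
proof -
  show 1: "R / (1 - \<nu> 1) \<le> B \<omega>" by (simp add: B_def)
  then show 2: "R \<le> (1 - \<nu> 1) * B \<omega>" using \<nu>_1 by (simp add: field_simps)
  show 3: "0 \<le> B \<omega>" by (simp add: B_def le_max_iff_disj)
  have "(1 - \<nu> 1) * B \<omega> \<le> 1 * B \<omega>"
    using 3 \<nu>_1 by (intro mult_right_mono) auto
  then show "R \<le> B \<omega>" using 2 by simp
qed

text \<open>For a step size up to 1/2 the new value is a convex combination of \<open>D n\<close>
  and the noise, whose norm is at most R \<le> B. Larger steps overshoot the batch mean and use the
  second entry of \<open>B\<close>.\<close>

lemma norm_D_le: "\<omega> \<in> space M \<Longrightarrow> norm (D n \<omega>) \<le> B \<omega>"
proof (induction n)
  case 0
  then show ?case by (simp add: B_def)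
next
  case (Suc n)
  let ?g = "step n \<omega>"
  have g: "0 < ?g" "?g \<le> \<nu> 1" "?g < 1" using step_pos step_le[of n \<omega>] \<nu>_1 by auto
  have "norm (D (Suc n) \<omega>) \<le> \<bar>1 - 2 * ?g\<bar> * norm (D n \<omega>) + 2 * ?g * norm (noise n \<omega>)"
    using Suc.prems norm_triangle_ineq[of "(1 - 2 * ?g) *\<^sub>R D n \<omega>" "(2 * ?g) *\<^sub>R noise n \<omega>"] g
    by (simp add: D_Suc)
  also have "\<dots> \<le> \<bar>1 - 2 * ?g\<bar> * B \<omega> + 2 * ?g * R"
    using Suc norm_noise_le[OF Suc.prems] g by (intro add_mono mult_left_mono) auto
  also have "\<dots> \<le> B \<omega>"
  proof (cases "?g \<le> 1/2")
    case True
    then show ?thesis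
      using mult_left_mono[OF B_ge(3)[of \<omega>], of "2 * ?g"] g by (simp add: algebra_simps)
  next
    case False
    \<comment> \<open>In the overshooting case the claim (2 g - 1) B + 2 g R \<le> B amounts to g R
      \<le> (1 - g) B.\<close>
    have "R \<le> (1 - ?g) * B \<omega>"
      using B_ge(2)[of \<omega>] mult_right_mono[of "1 - \<nu> 1" "1 - ?g" "B \<omega>"] g B_ge(4)[of \<omega>] by simp
    then have "2 * ?g * R \<le> 2 * ?g * ((1 - ?g) * B \<omega>)"
      using g by (intro mult_left_mono) auto
    moreover have "0 \<le> 2 * (1 - ?g)\<^sup>2 * B \<omega>" using B_ge(4) by simp
    ultimately show ?thesis
      using False by (simp add: power2_eq_square algebra_simps)
  qed
  finally show ?case .
qed

text \<open>Stated for an arbitrary sigma-algebra \<open>H\<close>, so that it serves both for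
  \<open>M\<close> and for the algebras that omit one sample. State and counter need a joint
  induction, since each step uses the counter and each counter update uses the next state. The
  second part asks only for the training samples of the last step, which leaves its test samples
  unseen.\<close>

lemma measurable_from_past:
  assumes H: "space H = space M" "\<Theta> 0 \<in> borel_measurable H"
    and "\<And>j m. 1 \<le> j \<Longrightarrow> j \<le> n \<Longrightarrow> X (int j) m \<in> borel_measurable H"
  shows "\<Theta> n \<in> borel_measurable H \<and> \<kappa> n \<in> measurable H (count_space UNIV)"
    and "(\<And>m. 1 \<le> m \<Longrightarrow> m \<le> Mb \<Longrightarrow> X (int (Suc n)) (int m) \<in> borel_measurable H) \<Longrightarrow>
      \<Theta> (Suc n) \<in> borel_measurable H"
proof -
  have \<Theta>: "\<Theta> (Suc n) \<in> borel_measurable H"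
    if [measurable]: "\<Theta> n \<in> borel_measurable H" "\<kappa> n \<in> measurable H (count_space UNIV)"
      and X: "\<And>m. 1 \<le> m \<Longrightarrow> m \<le> Mb \<Longrightarrow> X (int (Suc n)) (int m) \<in> borel_measurable H" for n
  proof -
    have [measurable]: "(\<lambda>\<omega>. \<Sum>m = 1..Mb. X (int (Suc n)) (int m) \<omega>) \<in> borel_measurable H"
      using X by (intro borel_measurable_sum) auto
    have "\<Theta> (Suc n) \<in> borel_measurable H \<longleftrightarrow>
        (\<lambda>\<omega>. \<Theta> n \<omega> - (2 * \<nu> (\<kappa> n \<omega>)) *\<^sub>R (\<Theta> n \<omega> -
          (1 / real Mb) *\<^sub>R (\<Sum>m = 1..Mb. X (int (Suc n)) (int m) \<omega>))) \<in> borel_measurable H"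
      by (rule measurable_cong) (simp add: H \<Theta>_Suc \<gamma>_eq_step step_def)
    also have \<dots>
      by measurable
    finally show ?thesis .
  qed
  show 1: "\<Theta> n \<in> borel_measurable H \<and> \<kappa> n \<in> measurable H (count_space UNIV)"
    using assms(3)
  proof (induction n)
    case 0
    then show ?case
      using H by (simp add: \<kappa>_def)
  next
    case (Suc n)
    have [measurable]: "X (int (Suc n)) m \<in> borel_measurable H" for m
      using Suc.prems[of "Suc n"] by simp
    have [measurable]: "\<Theta> n \<in> borel_measurable H" "\<kappa> n \<in> measurable H (count_space UNIV)"
      using Suc by auto
    have [measurable]: "\<Theta> (Suc n) \<in> borel_measurable H"
      by (rule \<Theta>) measurable
    have [measurable]: "incr n \<in> borel_measurable H"
      unfolding incr_def[abs_def] by measurable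
    have "\<kappa> (Suc n) \<in> measurable H (count_space UNIV)"
      unfolding \<kappa>_Suc[abs_def] by measurable
    then show ?case
      using \<open>\<Theta> (Suc n) \<in> _\<close> by simp
  qed
  show "\<Theta> (Suc n) \<in> borel_measurable H"
    if "\<And>m. 1 \<le> m \<Longrightarrow> m \<le> Mb \<Longrightarrow> X (int (Suc n)) (int m) \<in> borel_measurable H"
    using \<Theta>[of n] 1 that by blast
qed

lemma measurable_process [measurable]:
  "\<Theta> n \<in> borel_measurable M" "\<kappa> n \<in> measurable M (count_space UNIV)"
  "D n \<in> borel_measurable M" "step n \<in> borel_measurable M" "incr n \<in> borel_measurable M"
  "noise n \<in> borel_measurable M"
proof -
  show 1[measurable]: "\<Theta> n \<in> borel_measurable M" "\<kappa> n \<in> measurable M (count_space UNIV)" for n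
    using measurable_from_past(1)[of M n] by auto
  show "D n \<in> borel_measurable M"
    unfolding D_def[abs_def] by measurable
  show "step n \<in> borel_measurable M"
    unfolding step_def[abs_def] by measurable
  show "incr n \<in> borel_measurable M"
    unfolding incr_def[abs_def] by measurable
  show "noise n \<in> borel_measurable M"
    unfolding noise_def[abs_def] by measurable
qed

lemma B_measurable [measurable]: "B \<in> borel_measurable M"
  unfolding B_def[abs_def] by measurable

lemma integrable_B_squared [simp, intro]: "integrable M (\<lambda>\<omega>. (B \<omega>)\<^sup>2)"
proof (rule Bochner_Integration.integrable_bound)
  let ?C = "2 * (norm \<mu>)\<^sup>2 + (R / (1 - \<nu> 1))\<^sup>2"
  show "integrable M (\<lambda>\<omega>. 2 * (norm (\<Theta> 0 \<omega>))\<^sup>2 + ?C)"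
    using \<Theta>_0_L2 by auto
  have "(B \<omega>)\<^sup>2 \<le> 2 * (norm (\<Theta> 0 \<omega>))\<^sup>2 + ?C" for \<omega>
  proof -
    have "(norm (D 0 \<omega>))\<^sup>2 \<le> (norm (\<Theta> 0 \<omega>) + norm \<mu>)\<^sup>2"
      unfolding D_def by (intro power_mono norm_triangle_ineq4) auto
    also have "\<dots> \<le> 2 * (norm (\<Theta> 0 \<omega>))\<^sup>2 + 2 * (norm \<mu>)\<^sup>2"
      using sum_squares_bound[of "norm (\<Theta> 0 \<omega>)" "norm \<mu>"] by (simp add: power2_sum)
    finally show ?thesis
      by (auto simp: B_def max_def intro: order_trans)
  qed
  then show "AE \<omega> in M. norm ((B \<omega>)\<^sup>2) \<le> norm (2 * (norm (\<Theta> 0 \<omega>))\<^sup>2 + ?C)"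
    by (auto intro!: AE_I2 intro: order_trans[OF _ abs_ge_self])
qed measurable

lemma integrable_B [simp, intro]: "integrable M B"
  by (rule square_integrable_imp_integrable) auto

section \<open>Vanishing step sizes\<close>

text \<open>Whatever is computed without looking at \<open>X n m\<close> is measurable here, hence independent of \<open>X n m\<close>.\<close>

definition without :: "int \<Rightarrow> int \<Rightarrow> 'w measure" where
  "without n m = others borel (case_option (\<Theta> 0) (\<lambda>p. X (fst p) (snd p))) (Some (n, m))"

lemma space_without [simp]: "space (without n m) = space M"
  by (simp add: without_def)

lemma X_without: "(i, j) \<noteq> (n, m) \<Longrightarrow> X i j \<in> borel_measurable (without n m)"
  unfolding without_def
  using measurable_others[of "case_option (\<Theta> 0) (\<lambda>p. X (fst p) (snd p))" "Some (i, j)" borel "Some (n, m)"]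
  by simp

lemma \<Theta>_0_without: "\<Theta> 0 \<in> borel_measurable (without n m)"
  unfolding without_def
  using measurable_others[of "case_option (\<Theta> 0) (\<lambda>p. X (fst p) (snd p))" None borel "Some (n, m)"]
  by simp

lemma \<Theta>_without: "\<Theta> n \<in> borel_measurable (without (int (Suc n)) m)"
  and \<kappa>_without: "\<kappa> n \<in> measurable (without (int (Suc n)) m) (count_space UNIV)"
proof -
  have "X (int j) q \<in> borel_measurable (without (int (Suc n)) m)" if "j \<le> n" for j q
    using that by (intro X_without) auto
  then show "\<Theta> n \<in> borel_measurable (without (int (Suc n)) m)"
      "\<kappa> n \<in> measurable (without (int (Suc n)) m) (count_space UNIV)"
    using measurable_from_past(1)[OF space_without \<Theta>_0_without, of n "int (Suc n)" m] by auto
qed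

text \<open>A training step uses samples with positive second index, whereas test samples have a
  negative one. The state after the step is thus still independent of each single test sample of
  that step.\<close>

lemma \<Theta>_Suc_without: "1 \<le> m \<Longrightarrow> \<Theta> (Suc n) \<in> borel_measurable (without (int (Suc n)) (- int m))"
  by (rule measurable_from_past(2)[OF space_without \<Theta>_0_without]) (auto intro: X_without)

lemma indep_without: "indep_set {X n m -` A \<inter> space M |A. A \<in> sets borel} (sets (without n m))"
  using indep_set_others[OF indep_vars_case_option[OF X_indep \<Theta>_0_meas indep_X_\<Theta>0], of "Some (n, m)"]
  by (simp add: without_def)

lemma measurable_withoutD:
  "U \<in> measurable (without n m) T \<Longrightarrow> U \<in> measurable M T"
  by (rule measurable_indep_algebra[OF indep_without space_without X_meas])

text \<open>\<open>U\<close> is independent of the sample, whose mean is \<open>\<mu>\<close>, so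
  the expectation factors and the second factor vanishes.\<close>

lemma expectation_cross:
  assumes "U \<in> borel_measurable (without n m)" "integrable M U"
  shows "integrable M (\<lambda>\<omega>. U \<omega> \<bullet> (X n m \<omega> - \<mu>))" "expectation (\<lambda>\<omega>. U \<omega> \<bullet> (X n m \<omega> - \<mu>)) = 0"
proof -
  note * = expectation_inner_indep[OF indep_without space_without integrable_X assms(2,1)]
  show "integrable M (\<lambda>\<omega>. U \<omega> \<bullet> (X n m \<omega> - \<mu>))"
    using *(1) assms(2) by (simp add: inner_diff_right)
  show "expectation (\<lambda>\<omega>. U \<omega> \<bullet> (X n m \<omega> - \<mu>)) = 0"
    using * assms(2) by (simp add: inner_diff_right expectation_X)
qed

text \<open>The bound for deterministic coefficients holds for every sample with the same constant,
  as all have the same law. Freezing then admits random coefficients that do not involve the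
  sample.\<close>

lemma nn_integral_affine_indep_ge:
  obtains c where "0 < c"
    "\<And>n m r v. r \<in> borel_measurable (without n m) \<Longrightarrow> v \<in> borel_measurable (without n m) \<Longrightarrow>
      (\<integral>\<^sup>+\<omega>. ennreal (c * norm (v \<omega>)) \<partial>M) \<le> (\<integral>\<^sup>+\<omega>. ennreal \<bar>r \<omega> - v \<omega> \<bullet> X n m \<omega>\<bar> \<partial>M)"
proof -
  obtain c where c: "0 < c"
      "\<And>v r. ennreal (c * norm v) \<le> (\<integral>\<^sup>+\<omega>. ennreal \<bar>r - v \<bullet> X 0 0 \<omega>\<bar> \<partial>M)"
    using nn_integral_affine_ge[OF a_less_b X_meas X_supp] by blast
  have c': "ennreal (c * norm v) \<le> (\<integral>\<^sup>+\<omega>. ennreal \<bar>r - v \<bullet> X n m \<omega>\<bar> \<partial>M)" for v r n m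
  proof -
    have eq: "(\<integral>\<^sup>+\<omega>. ennreal \<bar>r - v \<bullet> X n m \<omega>\<bar> \<partial>M) =
        (\<integral>\<^sup>+x. ennreal \<bar>r - v \<bullet> x\<bar> \<partial>distr M borel (X n m))" for n m
      by (subst nn_integral_distr) auto
    show ?thesis
      using c(2)[of v r] unfolding eq X_ident[of n m] .
  qed
  show ?thesis
  proof (rule that[OF c(1)])
    fix n m and r :: "'w \<Rightarrow> real" and v :: "'w \<Rightarrow> real ^ 'd"
    assume [measurable]: "r \<in> borel_measurable (without n m)" "v \<in> borel_measurable (without n m)"
    have "(\<integral>\<^sup>+\<omega>. (\<lambda>u. ennreal (c * norm (snd u))) (r \<omega>, v \<omega>) \<partial>M) \<le>
        (\<integral>\<^sup>+\<omega>. (\<lambda>u x. ennreal \<bar>fst u - snd u \<bullet> x\<bar>) (r \<omega>, v \<omega>) (X n m \<omega>) \<partial>M)"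
    proof (rule nn_integral_indep_ge[OF indep_without space_without X_meas])
      show "(\<lambda>\<omega>. (r \<omega>, v \<omega>)) \<in> measurable (without n m) (borel \<Otimes>\<^sub>M borel)"
        by measurable
      show "(\<lambda>(u :: real \<times> (real ^ 'd), x). ennreal \<bar>fst u - snd u \<bullet> x\<bar>) \<in> borel_measurable ((borel \<Otimes>\<^sub>M borel) \<Otimes>\<^sub>M borel)"
        by measurable
    qed (rule c')
    then show "(\<integral>\<^sup>+\<omega>. ennreal (c * norm (v \<omega>)) \<partial>M) \<le> (\<integral>\<^sup>+\<omega>. ennreal \<bar>r \<omega> - v \<omega> \<bullet> X n m \<omega>\<bar> \<partial>M)"
      by simp
  qed
qed

section \<open>Expected time spent at large step sizes\<close>

definition active :: "nat \<Rightarrow> nat \<Rightarrow> 'w \<Rightarrow> real" where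
  "active k n \<omega> = (if \<kappa> n \<omega> \<le> k then 1 else 0)"

lemma active_measurable [measurable]: "active k n \<in> borel_measurable M"
  unfolding active_def[abs_def] by measurable

lemma active_without: "active k n \<in> borel_measurable (without (int (Suc n)) m)"
proof -
  note \<kappa>_without[measurable]
  show ?thesis unfolding active_def[abs_def] by measurable
qed

definition \<Delta> where "\<Delta> n \<omega> = D (Suc n) \<omega> - D n \<omega>"

lemma \<Delta>_measurable [measurable]: "\<Delta> n \<in> borel_measurable M"
  unfolding \<Delta>_def[abs_def] by measurable

lemma \<Delta>_without: "1 \<le> m \<Longrightarrow> \<Delta> n \<in> borel_measurable (without (int (Suc n)) (- int m))"
  using \<Theta>_without[of n "- int m"] \<Theta>_Suc_without[of m n]
  unfolding \<Delta>_def[abs_def] D_def by simp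

lemma norm_\<Delta>_le: "\<omega> \<in> space M \<Longrightarrow> norm (\<Delta> n \<omega>) \<le> 2 * B \<omega>"
  using norm_triangle_ineq4[of "D (Suc n) \<omega>" "D n \<omega>"] norm_D_le[of \<omega> n] norm_D_le[of \<omega> "Suc n"]
  by (simp add: \<Delta>_def)

text \<open>Expanding the squares around \<open>\<mu>\<close>, the terms quadratic in the test
  samples cancel. The increment is therefore affine in each test sample, with slope given by the
  displacement \<open>\<Delta> n\<close>.\<close>

lemma incr_eq:
  "incr n \<omega> = real Mf * ((norm (D (Suc n) \<omega>))\<^sup>2 - (norm (D n \<omega>))\<^sup>2) -
    (\<Sum>m = 1..Mf. (2 *\<^sub>R \<Delta> n \<omega>) \<bullet> (X (int (Suc n)) (- int m) \<omega> - \<mu>))"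
proof -
  have "(norm (\<Theta> (Suc n) \<omega> - x))\<^sup>2 - (norm (\<Theta> n \<omega> - x))\<^sup>2 =
      ((norm (D (Suc n) \<omega>))\<^sup>2 - (norm (D n \<omega>))\<^sup>2) - (2 *\<^sub>R \<Delta> n \<omega>) \<bullet> (x - \<mu>)" for x
    by (simp add: power2_norm_eq_inner D_def \<Delta>_def algebra_simps inner_diff_left inner_diff_right
        inner_add_left inner_add_right inner_commute)
  then show ?thesis
    unfolding incr_def by (simp only: sum_subtractf) (simp add: right_diff_distrib)
qed

lemma abs_incr_le:
  assumes "\<omega> \<in> space M"
  shows "\<bar>incr n \<omega>\<bar> \<le> 4 * real Mf * (B \<omega>)\<^sup>2"
proof -
  have sq: "(norm (\<Theta> i \<omega> - X p q \<omega>))\<^sup>2 \<le> 4 * (B \<omega>)\<^sup>2" for i p q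
  proof -
    have "norm (\<Theta> i \<omega> - X p q \<omega>) \<le> norm (D i \<omega>) + norm (X p q \<omega> - \<mu>)"
      using norm_triangle_ineq4[of "D i \<omega>" "X p q \<omega> - \<mu>"] by (simp add: D_def)
    also have "\<dots> \<le> 2 * B \<omega>"
      using norm_D_le[OF assms] norm_X_diff_le[OF assms, of p q] B_ge(3)[of \<omega>] by (smt (verit))
    finally have "(norm (\<Theta> i \<omega> - X p q \<omega>))\<^sup>2 \<le> (2 * B \<omega>)\<^sup>2"
      by (intro power_mono) auto
    then show ?thesis
      by (simp add: power_mult_distrib)
  qed
  have "\<bar>incr n \<omega>\<bar> \<le> (\<Sum>m = 1..Mf. 4 * (B \<omega>)\<^sup>2)"
    unfolding incr_def
  proof (rule order_trans[OF sum_abs sum_mono])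
    fix m
    show "\<bar>(norm (\<Theta> (Suc n) \<omega> - X (int (Suc n)) (- int m) \<omega>))\<^sup>2 -
        (norm (\<Theta> n \<omega> - X (int (Suc n)) (- int m) \<omega>))\<^sup>2\<bar> \<le> 4 * (B \<omega>)\<^sup>2"
      using sq[of "Suc n" "int (Suc n)" "- int m"] sq[of n "int (Suc n)" "- int m"]
        zero_le_power2[of "norm (\<Theta> (Suc n) \<omega> - X (int (Suc n)) (- int m) \<omega>)"]
        zero_le_power2[of "norm (\<Theta> n \<omega> - X (int (Suc n)) (- int m) \<omega>)"]
      by (intro abs_leI) linarith+
  qed
  then show ?thesis by (simp add: mult_ac)
qed

lemma active_bounds: "0 \<le> active k n \<omega>" "active k n \<omega> \<le> 1" "\<bar>active k n \<omega>\<bar> = active k n \<omega>"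
  by (auto simp: active_def)

lemma integrable_active_incr [simp, intro]: "integrable M (\<lambda>\<omega>. active k n \<omega> * incr n \<omega>)"
proof (rule Bochner_Integration.integrable_bound)
  show "AE \<omega> in M. norm (active k n \<omega> * incr n \<omega>) \<le> norm (4 * real Mf * (B \<omega>)\<^sup>2)"
    using abs_incr_le by (intro AE_I2) (auto simp: active_def)
qed (auto)

lemma integrable_norm_D_squared [simp, intro]: "integrable M (\<lambda>\<omega>. (norm (D n \<omega>))\<^sup>2)"
proof (rule Bochner_Integration.integrable_bound)
  show "AE \<omega> in M. norm ((norm (D n \<omega>))\<^sup>2) \<le> norm ((B \<omega>)\<^sup>2)"
    using norm_D_le by (intro AE_I2) (auto intro!: power_mono)
qed auto

lemma integrable_active_norm_D [simp, intro]:
  "integrable M (\<lambda>\<omega>. active k n \<omega> * ((norm (D (Suc n) \<omega>))\<^sup>2 - (norm (D n \<omega>))\<^sup>2))"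
proof (rule Bochner_Integration.integrable_bound)
  show "integrable M (\<lambda>\<omega>. (norm (D (Suc n) \<omega>))\<^sup>2 - (norm (D n \<omega>))\<^sup>2)"
    by auto
qed (auto simp: active_def)

text \<open>The part of the increment that is linear in the centred test samples has mean 0, because
  neither the displacement nor the indicator involves the test sample in question.\<close>

lemma expectation_active_incr:
  "expectation (\<lambda>\<omega>. active k n \<omega> * incr n \<omega>) =
    real Mf * expectation (\<lambda>\<omega>. active k n \<omega> * ((norm (D (Suc n) \<omega>))\<^sup>2 - (norm (D n \<omega>))\<^sup>2))"
proof -
  let ?U = "\<lambda>\<omega>. active k n \<omega> *\<^sub>R 2 *\<^sub>R \<Delta> n \<omega>"
  have U: "?U \<in> borel_measurable (without (int (Suc n)) (- int m))" if "1 \<le> m" for m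
  proof -
    note [measurable] = active_without \<Delta>_without[OF that]
    show ?thesis by measurable
  qed
  have int: "integrable M ?U"
  proof (rule Bochner_Integration.integrable_bound)
    show "integrable M (\<lambda>\<omega>. 4 * B \<omega>)" by auto
    show "AE \<omega> in M. norm (?U \<omega>) \<le> norm (4 * B \<omega>)"
      using norm_\<Delta>_le B_ge(4) by (intro AE_I2) (force simp: active_def)
  qed measurable
  note cross = expectation_cross[OF U int]
  have "expectation (\<lambda>\<omega>. active k n \<omega> * incr n \<omega>) =
      expectation (\<lambda>\<omega>. real Mf * (active k n \<omega> * ((norm (D (Suc n) \<omega>))\<^sup>2 - (norm (D n \<omega>))\<^sup>2)) -
        (\<Sum>m = 1..Mf. ?U \<omega> \<bullet> (X (int (Suc n)) (- int m) \<omega> - \<mu>)))"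
    by (simp add: incr_eq right_diff_distrib sum_distrib_left mult_ac)
  also have "\<dots> = real Mf * expectation (\<lambda>\<omega>. active k n \<omega> * ((norm (D (Suc n) \<omega>))\<^sup>2 - (norm (D n \<omega>))\<^sup>2)) -
      (\<Sum>m = 1..Mf. expectation (\<lambda>\<omega>. ?U \<omega> \<bullet> (X (int (Suc n)) (- int m) \<omega> - \<mu>)))"
    using cross(1) by (subst Bochner_Integration.integral_diff)
      (auto intro!: integrable_mult_right Bochner_Integration.integrable_sum simp: Bochner_Integration.integral_sum simp del: inner_scaleR_left)
  finally show ?thesis
    using cross(2) by simp
qed

lemma integrable_active [simp, intro]: "integrable M (active k n)"
  by (rule integrable_const_bound[of _ 1]) (auto simp: active_def)

text \<open>Anti-concentration is used twice. Over the first test sample it bounds the mean of the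
  absolute increment below by a multiple of the mean displacement. Over the first training sample it
  bounds the mean displacement below by a multiple of the step size, which is at least
  \<open>\<nu> k\<close> while active.\<close>

lemma expectation_active_incr_ge:
  assumes "1 \<le> k"
  obtains c where "0 < c"
    "\<And>n. c * expectation (active k n) \<le> expectation (\<lambda>\<omega>. active k n \<omega> * \<bar>incr n \<omega>\<bar>)"
proof -
  obtain c where c: "0 < c" and ge:
      "\<And>n m r v. r \<in> borel_measurable (without n m) \<Longrightarrow> v \<in> borel_measurable (without n m) \<Longrightarrow>
      (\<integral>\<^sup>+\<omega>. ennreal (c * norm (v \<omega>)) \<partial>M) \<le> (\<integral>\<^sup>+\<omega>. ennreal \<bar>r \<omega> - v \<omega> \<bullet> X n m \<omega>\<bar> \<partial>M)"
    by (rule nn_integral_affine_indep_ge) blast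
  \<comment> \<open>One factor \<open>c\<close> for each application; the leading 2 is the slope
    \<open>2 *\<^sub>R \<Delta> n\<close>, and \<open>2 * \<nu> k / real Mb\<close> is the least
    weight of one training sample in an active step.\<close>
  define C where "C = 2 * c * (c * (2 * \<nu> k / real Mb))"
  have \<nu>: "0 < \<nu> k" using \<nu>_range assms by auto
  have C: "0 < C" using c \<nu> Mb by (simp add: C_def)
  have "C * expectation (active k n) \<le> expectation (\<lambda>\<omega>. active k n \<omega> * \<bar>incr n \<omega>\<bar>)" for n
  proof -
    let ?t = "int (Suc n)"
    have test: "(\<integral>\<^sup>+\<omega>. ennreal (c * norm (active k n \<omega> *\<^sub>R 2 *\<^sub>R \<Delta> n \<omega>)) \<partial>M) \<le>
        (\<integral>\<^sup>+\<omega>. ennreal (active k n \<omega> * \<bar>incr n \<omega>\<bar>) \<partial>M)"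
    proof -
      \<comment> \<open>All of the active increment that does not involve the first test sample. The
        last term undoes the centring of that sample.\<close>
      define r where "r \<omega> = active k n \<omega> * (real Mf * ((norm (D (Suc n) \<omega>))\<^sup>2 - (norm (D n \<omega>))\<^sup>2) -
        (\<Sum>m = 2..Mf. (2 *\<^sub>R \<Delta> n \<omega>) \<bullet> (X ?t (- int m) \<omega> - \<mu>)) + (2 *\<^sub>R \<Delta> n \<omega>) \<bullet> \<mu>)" for \<omega>
      have [measurable]: "D n \<in> borel_measurable (without ?t (- 1))"
          "D (Suc n) \<in> borel_measurable (without ?t (- 1))"
          "active k n \<in> borel_measurable (without ?t (- 1))" "\<Delta> n \<in> borel_measurable (without ?t (- 1))"
        using \<Theta>_without[of n "- 1"] \<Theta>_Suc_without[of 1 n] active_without[of k n "- 1"] \<Delta>_without[of 1 n]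
        unfolding D_def[abs_def] by simp_all
      have [measurable]: "(\<lambda>\<omega>. \<Sum>m = 2..Mf. (2 *\<^sub>R \<Delta> n \<omega>) \<bullet> (X ?t (- int m) \<omega> - \<mu>))
          \<in> borel_measurable (without ?t (- 1))"
      proof (rule borel_measurable_sum)
        fix m assume "m \<in> {2..Mf}"
        then have [measurable]: "X ?t (- int m) \<in> borel_measurable (without ?t (- 1))"
          by (intro X_without) auto
        show "(\<lambda>\<omega>. (2 *\<^sub>R \<Delta> n \<omega>) \<bullet> (X ?t (- int m) \<omega> - \<mu>)) \<in> borel_measurable (without ?t (- 1))"
          by measurable
      qed
      have "r \<in> borel_measurable (without ?t (- 1))"
        unfolding r_def[abs_def] by measurable
      moreover have "(\<lambda>\<omega>. active k n \<omega> *\<^sub>R 2 *\<^sub>R \<Delta> n \<omega>) \<in> borel_measurable (without ?t (- 1))"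
        by measurable
      moreover have "r \<omega> - (active k n \<omega> *\<^sub>R 2 *\<^sub>R \<Delta> n \<omega>) \<bullet> X ?t (- 1) \<omega> = active k n \<omega> * incr n \<omega>" for \<omega>
      proof -
        have "(\<Sum>m = 1..Mf. (2 *\<^sub>R \<Delta> n \<omega>) \<bullet> (X ?t (- int m) \<omega> - \<mu>)) =
            (2 *\<^sub>R \<Delta> n \<omega>) \<bullet> (X ?t (- 1) \<omega> - \<mu>) +
            (\<Sum>m = 2..Mf. (2 *\<^sub>R \<Delta> n \<omega>) \<bullet> (X ?t (- int m) \<omega> - \<mu>))"
          using Mf by (subst sum.atLeast_Suc_atMost) (auto simp: numeral_2_eq_2)
        then show ?thesis
          unfolding incr_eq r_def by (simp only:) (simp add: inner_diff_right algebra_simps)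
      qed
      then have "\<bar>r \<omega> - (active k n \<omega> *\<^sub>R 2 *\<^sub>R \<Delta> n \<omega>) \<bullet> X ?t (- 1) \<omega>\<bar> = active k n \<omega> * \<bar>incr n \<omega>\<bar>" for \<omega>
        by (simp only:) (simp add: abs_mult active_bounds)
      ultimately show ?thesis
        using ge[of r ?t "- 1" "\<lambda>\<omega>. active k n \<omega> *\<^sub>R 2 *\<^sub>R \<Delta> n \<omega>"] by simp
    qed
    have move: "(\<integral>\<^sup>+\<omega>. ennreal (c * (2 * \<nu> k / real Mb) * active k n \<omega>) \<partial>M) \<le>
        (\<integral>\<^sup>+\<omega>. ennreal (norm (active k n \<omega> *\<^sub>R \<Delta> n \<omega>)) \<partial>M)"
    proof -
      \<comment> \<open>Projecting onto an arbitrary coordinate direction makes the displacement a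
        scalar affine functional of a training sample and can only shrink its norm.\<close>
      define e :: "real ^ 'd" where "e = axis undefined 1"
      have e: "norm e = 1" by (simp add: e_def)
      define s where "s \<omega> = active k n \<omega> * (2 * step n \<omega>)" for \<omega>
      define r where "r \<omega> = s \<omega> * (\<Theta> n \<omega> \<bullet> e - (1 / real Mb) * (\<Sum>m = 2..Mb. X ?t (int m) \<omega> \<bullet> e))" for \<omega>
      define v where "v \<omega> = (s \<omega> / real Mb) *\<^sub>R e" for \<omega>
      note [measurable] = \<Theta>_without[of n 1] active_without[of k n 1] \<kappa>_without[of n 1]
      have [measurable]: "s \<in> borel_measurable (without ?t 1)"
        unfolding s_def[abs_def] step_def by measurable
      have [measurable]: "(\<lambda>\<omega>. \<Sum>m = 2..Mb. X ?t (int m) \<omega> \<bullet> e) \<in> borel_measurable (without ?t 1)"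
      proof (rule borel_measurable_sum)
        fix m assume "m \<in> {2..Mb}"
        then have [measurable]: "X ?t (int m) \<in> borel_measurable (without ?t 1)"
          by (intro X_without) auto
        show "(\<lambda>\<omega>. X ?t (int m) \<omega> \<bullet> e) \<in> borel_measurable (without ?t 1)"
          by measurable
      qed
      have "r \<in> borel_measurable (without ?t 1)" "v \<in> borel_measurable (without ?t 1)"
        unfolding r_def[abs_def] v_def[abs_def] by measurable
      note ge = ge[OF this]
      have "\<bar>r \<omega> - v \<omega> \<bullet> X ?t 1 \<omega>\<bar> \<le> norm (active k n \<omega> *\<^sub>R \<Delta> n \<omega>)" if "\<omega> \<in> space M" for \<omega>
      proof -
        have "(\<Sum>m = 1..Mb. X ?t (int m) \<omega>) = X ?t 1 \<omega> + (\<Sum>m = 2..Mb. X ?t (int m) \<omega>)"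
          using Mb by (subst sum.atLeast_Suc_atMost) (auto simp: numeral_2_eq_2)
        then have "r \<omega> - v \<omega> \<bullet> X ?t 1 \<omega> = - ((active k n \<omega> *\<^sub>R \<Delta> n \<omega>) \<bullet> e)"
          unfolding r_def v_def s_def \<Delta>_def D_Suc[OF that] noise_def
          by (simp add: D_def inner_sum_left inner_add_left inner_diff_left inner_commute[of e] algebra_simps)
        then show ?thesis
          using Cauchy_Schwarz_ineq2[of "active k n \<omega> *\<^sub>R \<Delta> n \<omega>" e] e by simp
      qed
      then have "(\<integral>\<^sup>+\<omega>. ennreal \<bar>r \<omega> - v \<omega> \<bullet> X ?t 1 \<omega>\<bar> \<partial>M) \<le>
          (\<integral>\<^sup>+\<omega>. ennreal (norm (active k n \<omega> *\<^sub>R \<Delta> n \<omega>)) \<partial>M)"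
        by (intro nn_integral_mono ennreal_leI)
      moreover have "(\<integral>\<^sup>+\<omega>. ennreal (c * (2 * \<nu> k / real Mb) * active k n \<omega>) \<partial>M) \<le>
          (\<integral>\<^sup>+\<omega>. ennreal (c * norm (v \<omega>)) \<partial>M)"
      proof (intro nn_integral_mono ennreal_leI)
        fix \<omega>
        have "\<nu> k * active k n \<omega> \<le> step n \<omega> * active k n \<omega>"
          using \<nu>_antimono[OF \<kappa>_ge_1, of n \<omega> k] by (simp add: active_def step_def)
        moreover have "norm (v \<omega>) = 2 * step n \<omega> * active k n \<omega> / real Mb"
          using step_pos[of n \<omega>] by (simp add: v_def s_def e active_bounds abs_mult)
        ultimately show "c * (2 * \<nu> k / real Mb) * active k n \<omega> \<le> c * norm (v \<omega>)"
          using c Mb by (simp add: divide_right_mono)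
      qed
      ultimately show ?thesis using ge by (meson order_trans)
    qed
    have "ennreal (C * expectation (active k n)) = (\<integral>\<^sup>+\<omega>. ennreal (C * active k n \<omega>) \<partial>M)"
      using C by (subst nn_integral_eq_integral) (auto simp: active_bounds)
    also have "\<dots> = ennreal (2 * c) * (\<integral>\<^sup>+\<omega>. ennreal (c * (2 * \<nu> k / real Mb) * active k n \<omega>) \<partial>M)"
      using c \<nu> by (subst nn_integral_cmult[symmetric])
        (auto simp: ennreal_mult'[symmetric] C_def active_bounds mult_ac intro!: nn_integral_cong)
    also have "\<dots> \<le> ennreal (2 * c) * (\<integral>\<^sup>+\<omega>. ennreal (norm (active k n \<omega> *\<^sub>R \<Delta> n \<omega>)) \<partial>M)"
      by (intro mult_left_mono move) auto
    also have "\<dots> = (\<integral>\<^sup>+\<omega>. ennreal (c * norm (active k n \<omega> *\<^sub>R 2 *\<^sub>R \<Delta> n \<omega>)) \<partial>M)"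
      using c by (subst nn_integral_cmult[symmetric])
        (auto simp: ennreal_mult'[symmetric] active_bounds mult_ac intro!: nn_integral_cong)
    also have "\<dots> \<le> (\<integral>\<^sup>+\<omega>. ennreal (active k n \<omega> * \<bar>incr n \<omega>\<bar>) \<partial>M)"
      by (rule test)
    also have "\<dots> = ennreal (expectation (\<lambda>\<omega>. active k n \<omega> * \<bar>incr n \<omega>\<bar>))"
      using integrable_abs[OF integrable_active_incr[of k n]]
      by (subst nn_integral_eq_integral) (auto simp: active_bounds abs_mult)
    finally show ?thesis
      by (subst (asm) ennreal_le_iff) (auto intro!: Bochner_Integration.integral_nonneg simp: active_bounds)
  qed
  with C show ?thesis by (rule that)
qed

text \<open>The indicator is 1 up to a random time and 0 afterwards, so the sum telescopes to the
  squared norm at that time minus the initial one.\<close>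

lemma sum_active_norm_D_ge:
  "- (norm (D 0 \<omega>))\<^sup>2 \<le> (\<Sum>n<K. active k n \<omega> * ((norm (D (Suc n) \<omega>))\<^sup>2 - (norm (D n \<omega>))\<^sup>2))"
proof -
  let ?S = "\<lambda>K. \<Sum>n<K. active k n \<omega> * ((norm (D (Suc n) \<omega>))\<^sup>2 - (norm (D n \<omega>))\<^sup>2)"
  \<comment> \<open>The induction carries the exact telescoped value while still active; afterwards
    the sum stays frozen.\<close>
  have "- (norm (D 0 \<omega>))\<^sup>2 \<le> ?S K \<and> (\<kappa> K \<omega> \<le> k \<longrightarrow> ?S K = (norm (D K \<omega>))\<^sup>2 - (norm (D 0 \<omega>))\<^sup>2)"
  proof (induction K)
    case (Suc K)
    then show ?case
      using \<kappa>_mono[of K "Suc K" \<omega>] by (auto simp: active_def)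
  qed simp
  then show ?thesis ..
qed

text \<open>Every positive increment raises \<open>\<kappa>\<close> by one, and an active time has
  \<open>\<kappa>\<close> at most \<open>k\<close>. Hence at most \<open>k\<close> positive
  increments are counted.\<close>

lemma sum_active_pos_incr_le:
  assumes "\<omega> \<in> space M"
  shows "(\<Sum>n<K. active k n \<omega> * max 0 (incr n \<omega>)) \<le> real k * (4 * real Mf * (B \<omega>)\<^sup>2)"
proof -
  let ?b = "4 * real Mf * (B \<omega>)\<^sup>2"
  \<comment> \<open>\<open>\<kappa> K \<omega> - 1\<close> is the number of increases before time
    \<open>K\<close>. The cap at \<open>k\<close> remains valid once the active phase is
    over.\<close>
  have "(\<Sum>n<K. active k n \<omega> * max 0 (incr n \<omega>)) \<le> real (min (\<kappa> K \<omega> - 1) k) * ?b"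
  proof (induction K)
    case (Suc K)
    show ?case
    proof (cases "0 < incr K \<omega> \<and> \<kappa> K \<omega> \<le> k")
      case True
      obtain j where j: "\<kappa> K \<omega> = Suc j"
        by (simp add: \<kappa>_def)
      then have "\<kappa> (Suc K) \<omega> = Suc (Suc j)"
        using True by (subst \<kappa>_Suc) simp
      then have "real (min (\<kappa> (Suc K) \<omega> - 1) k) * ?b = real (min (\<kappa> K \<omega> - 1) k) * ?b + ?b"
        using True j by (simp add: distrib_right)
      moreover have "active k K \<omega> * max 0 (incr K \<omega>) \<le> ?b"
        using True abs_incr_le[OF assms, of K] by (auto simp: active_def)
      ultimately show ?thesis
        using Suc by (simp only: sum.lessThan_Suc)
    next
      case False
      have "real (min (\<kappa> K \<omega> - 1) k) * ?b \<le> real (min (\<kappa> (Suc K) \<omega> - 1) k) * ?b"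
        using \<kappa>_mono[of K "Suc K" \<omega>] by (intro mult_right_mono) auto
      moreover have "active k K \<omega> * max 0 (incr K \<omega>) = 0"
        using False by (auto simp: active_def)
      ultimately show ?thesis
        using Suc by (simp only: sum.lessThan_Suc)
    qed
  qed simp
  also have "\<dots> \<le> real k * ?b"
    by (intro mult_right_mono) auto
  finally show ?thesis .
qed

text \<open>The absolute increments dominate the active time in mean. They are summed via
  \<bar>x\<bar> = 2 max 0 x - x: the positive parts are few and bounded, and the signed sum
  telescopes in mean.\<close>

lemma sum_expectation_active_bounded:
  assumes "1 \<le> k"
  obtains C where "\<And>K. (\<Sum>n<K. expectation (active k n)) \<le> C"
proof -
  obtain c where c: "0 < c"
      "\<And>n. c * expectation (active k n) \<le> expectation (\<lambda>\<omega>. active k n \<omega> * \<bar>incr n \<omega>\<bar>)"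
    using expectation_active_incr_ge[OF assms] by blast
  define C where "C = 2 * (real k * (4 * real Mf * expectation (\<lambda>\<omega>. (B \<omega>)\<^sup>2))) +
    real Mf * expectation (\<lambda>\<omega>. (B \<omega>)\<^sup>2)"
  have "(\<Sum>n<K. expectation (active k n)) \<le> C / c" for K
  proof -
    let ?V = "\<lambda>n \<omega>. active k n \<omega> * ((norm (D (Suc n) \<omega>))\<^sup>2 - (norm (D n \<omega>))\<^sup>2)"
    have abs_eq: "active k n \<omega> * \<bar>incr n \<omega>\<bar> = 2 * (active k n \<omega> * max 0 (incr n \<omega>)) - active k n \<omega> * incr n \<omega>" for n \<omega>
      by (auto simp: max_def)
    have int_pos: "integrable M (\<lambda>\<omega>. active k n \<omega> * max 0 (incr n \<omega>))" for n
      by (rule Bochner_Integration.integrable_bound[OF integrable_active_incr[of k n]])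
        (auto simp: active_def)
    have "c * (\<Sum>n<K. expectation (active k n)) \<le> (\<Sum>n<K. expectation (\<lambda>\<omega>. active k n \<omega> * \<bar>incr n \<omega>\<bar>))"
      unfolding sum_distrib_left by (intro sum_mono c)
    also have "\<dots> = (\<Sum>n<K. 2 * expectation (\<lambda>\<omega>. active k n \<omega> * max 0 (incr n \<omega>)) -
        real Mf * expectation (?V n))"
      unfolding abs_eq using int_pos by (simp add: expectation_active_incr)
    also have "\<dots> = 2 * expectation (\<lambda>\<omega>. \<Sum>n<K. active k n \<omega> * max 0 (incr n \<omega>)) -
        real Mf * expectation (\<lambda>\<omega>. \<Sum>n<K. ?V n \<omega>)"
      using int_pos by (simp add: sum_subtractf sum_distrib_left Bochner_Integration.integral_sum)
    also have "\<dots> \<le> 2 * expectation (\<lambda>\<omega>. real k * (4 * real Mf * (B \<omega>)\<^sup>2)) -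
        real Mf * expectation (\<lambda>\<omega>. - (B \<omega>)\<^sup>2)"
    proof (intro diff_mono mult_left_mono integral_mono)
      show "- (B \<omega>)\<^sup>2 \<le> (\<Sum>n<K. ?V n \<omega>)" if "\<omega> \<in> space M" for \<omega>
        using sum_active_norm_D_ge[of \<omega> k K] power_mono[OF norm_D_le[OF that, of 0], of 2] by simp
    qed (use int_pos sum_active_pos_incr_le in auto)
    also have "\<dots> = C"
      by (simp add: C_def)
    finally show ?thesis
      using c(1) by (simp add: field_simps)
  qed
  then show ?thesis by (rule that)
qed

text \<open>On the event that \<open>\<kappa>\<close> never exceeds \<open>k\<close> every time is
  active. If it had positive probability, the expected active time up to \<open>K\<close> would grow
  at least linearly in \<open>K\<close>.\<close>

lemma AE_\<kappa>_gt: "AE \<omega> in M. \<exists>n. k < \<kappa> n \<omega>"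
proof (cases "1 \<le> k")
  case False
  then have "k < \<kappa> 0 \<omega>" for \<omega> by simp
  then show ?thesis by blast
next
  case True
  then obtain C where C: "\<And>K. (\<Sum>n<K. expectation (active k n)) \<le> C"
    using sum_expectation_active_bounded by blast
  let ?E = "{\<omega> \<in> space M. \<forall>n. \<kappa> n \<omega> \<le> k}"
  have E: "?E \<in> sets M" by measurable
  have int_E: "integrable M (indicator ?E :: 'w \<Rightarrow> real)"
    by (rule integrable_real_indicator[OF E]) (simp add: less_top[symmetric])
  have "prob ?E \<le> expectation (active k n)" for n
  proof -
    have "prob ?E = expectation (indicator ?E)"
      using sets.sets_into_space[OF E] by (simp add: Int_absorb2)
    also have "\<dots> \<le> expectation (active k n)"
    proof (rule integral_mono[OF int_E integrable_active])
      show "indicator ?E \<omega> \<le> active k n \<omega>" for \<omega>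
        by (cases "\<omega> \<in> ?E") (auto simp: active_def)
    qed
    finally show ?thesis .
  qed
  then have "real K * prob ?E \<le> C" for K
    using sum_mono[of "{..<K}" "\<lambda>_. prob ?E" "\<lambda>n. expectation (active k n)"] C[of K] by simp
  then have "\<not> 0 < prob ?E"
    using reals_Archimedean3[of "prob ?E"] by (meson not_less)
  then have "prob ?E = 0"
    by (simp add: zero_less_measure_iff)
  then have "emeasure M ?E = 0"
    by (simp only: emeasure_eq_measure ennreal_0)
  then show ?thesis
    using E by (intro AE_I[of _ _ ?E]) (auto simp: not_less)
qed

lemma AE_step_tendsto_0: "AE \<omega> in M. (\<lambda>n. step n \<omega>) \<longlonglongrightarrow> 0"
proof -
  have "AE \<omega> in M. \<forall>k. \<exists>n. k < \<kappa> n \<omega>"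
    using AE_\<kappa>_gt by (simp add: AE_all_countable)
  then show ?thesis
  proof eventually_elim
    case (elim \<omega>)
    have "filterlim (\<lambda>n. \<kappa> n \<omega>) at_top sequentially"
      unfolding filterlim_at_top eventually_sequentially
      using elim by (meson \<kappa>_mono less_imp_le order_trans)
    then show ?case
      unfolding step_def by (rule filterlim_compose[OF \<nu>_lim])
  qed
qed

section \<open>Convergence\<close>

definition T where "T n \<omega> = (\<Sum>i<n. step i \<omega>)"

text \<open>For a step size g \<le> \<open>\<nu> 1\<close> one has (1 - 2 g)^2 = 1 - 4 (1 - g) g
  \<le> 1 - \<open>rate\<close> g, so \<open>rate\<close> is a contraction rate valid for all
  steps.\<close>

definition rate where "rate = 4 * (1 - \<nu> 1)"

text \<open>The integrating factor that compensates this contraction.\<close>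

definition growth where "growth n \<omega> = exp (rate * T n \<omega>)"

text \<open>Indicator that \<open>n\<close> lies strictly before the hitting time of level
  \<open>t\<close>. It turns sums up to a random time into sums with random weights.\<close>

definition running :: "real \<Rightarrow> nat \<Rightarrow> 'w \<Rightarrow> real" where
  "running t n \<omega> = (if T n \<omega> < t then 1 else 0)"

text \<open>A deterministic time by which every path of \<open>T\<close> has reached
  \<open>t\<close>; any such index serves, hence \<open>SOME\<close>.\<close>

definition horizon :: "real \<Rightarrow> nat" where
  "horizon t = (SOME L. t \<le> (\<Sum>n = 1..L. \<nu> n))"

lemma rate_pos: "0 < rate"
  using \<nu>_1 by (simp add: rate_def)

lemma T_Suc: "T (Suc n) \<omega> = T n \<omega> + step n \<omega>"
  by (simp add: T_def)

lemma T_horizon: "t \<le> T (horizon t) \<omega>"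
proof -
  have "\<exists>L. t \<le> (\<Sum>n = 1..L. \<nu> n)"
    using \<nu>_div unfolding filterlim_at_top by (auto simp: eventually_sequentially)
  then have "t \<le> (\<Sum>n = 1..horizon t. \<nu> n)"
    unfolding horizon_def by (rule someI_ex)
  also have "\<dots> = (\<Sum>i<horizon t. \<nu> (Suc i))"
    by (rule sum.reindex_bij_witness[of _ Suc "\<lambda>i. i - 1"]) auto
  also have "\<dots> \<le> T (horizon t) \<omega>"
    unfolding T_def by (intro sum_mono step_ge)
  finally show ?thesis .
qed

lemma T_Suc_le: "T n \<omega> < t \<Longrightarrow> T (Suc n) \<omega> \<le> t + 1"
  using step_le[of n \<omega>] \<nu>_1 by (simp add: T_Suc)

lemma growth_Suc: "growth (Suc n) \<omega> = exp (rate * step n \<omega>) * growth n \<omega>"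
  by (simp add: growth_def T_Suc exp_add[symmetric] algebra_simps)

lemma growth_pos: "0 < growth n \<omega>"
  by (simp add: growth_def)

lemma growth_mono: "growth n \<omega> \<le> growth (Suc n) \<omega>"
  using rate_pos step_pos[of n \<omega>] by (simp add: growth_def T_Suc)

lemma T_growth_measurable [measurable]:
  "T n \<in> borel_measurable M" "growth n \<in> borel_measurable M" "running t n \<in> borel_measurable M"
proof -
  show [measurable]: "T n \<in> borel_measurable M"
    unfolding T_def[abs_def] by measurable
  show "growth n \<in> borel_measurable M" "running t n \<in> borel_measurable M"
    unfolding growth_def[abs_def] running_def[abs_def] by measurable
qed

lemma running_growth_le: "0 \<le> running t n \<omega> * growth (Suc n) \<omega>"
    "running t n \<omega> * growth (Suc n) \<omega> \<le> exp (rate * (t + 1))"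
  using T_Suc_le[of n \<omega> t] rate_pos by (auto simp: running_def growth_def)

text \<open>The squared recursion multiplied by the integrating factor: the contraction turns
  \<open>growth (Suc n)\<close> back into \<open>growth n\<close>, and the squared noise is replaced
  by its bound.\<close>

lemma growth_norm_D_Suc_le:
  assumes "\<omega> \<in> space M"
  shows "growth (Suc n) \<omega> * (norm (D (Suc n) \<omega>))\<^sup>2 \<le> growth n \<omega> * (norm (D n \<omega>))\<^sup>2 +
    growth (Suc n) \<omega> * (4 * (1 - 2 * step n \<omega>) * step n \<omega> * (D n \<omega> \<bullet> noise n \<omega>) + 4 * R\<^sup>2 * (step n \<omega>)\<^sup>2)"
proof -
  let ?g = "step n \<omega>"
  have g: "0 < ?g" "?g \<le> \<nu> 1" "?g < 1"
    using step_pos step_le[of n \<omega>] \<nu>_1 by auto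
  have "(norm (D (Suc n) \<omega>))\<^sup>2 = (1 - 2 * ?g)\<^sup>2 * (norm (D n \<omega>))\<^sup>2 +
      4 * (1 - 2 * ?g) * ?g * (D n \<omega> \<bullet> noise n \<omega>) + 4 * ?g\<^sup>2 * (norm (noise n \<omega>))\<^sup>2"
    unfolding D_Suc[OF assms] power2_norm_eq_inner
    by (simp add: inner_add_left inner_add_right inner_commute power2_eq_square algebra_simps)
  moreover have "4 * ?g\<^sup>2 * (norm (noise n \<omega>))\<^sup>2 \<le> 4 * ?g\<^sup>2 * R\<^sup>2"
    using norm_noise_le[OF assms] by (intro mult_left_mono power_mono) auto
  moreover have "(1 - 2 * ?g)\<^sup>2 * (norm (D n \<omega>))\<^sup>2 \<le> exp (- rate * ?g) * (norm (D n \<omega>))\<^sup>2"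
  proof (rule mult_right_mono)
    have "(1 - 2 * ?g)\<^sup>2 = 1 - 4 * (1 - ?g) * ?g"
      by (simp add: power2_eq_square algebra_simps)
    also have "\<dots> \<le> 1 - rate * ?g"
      using g unfolding rate_def by (intro diff_left_mono mult_right_mono) auto
    also have "\<dots> \<le> exp (- rate * ?g)"
      using exp_ge_add_one_self[of "- rate * ?g"] by simp
    finally show "(1 - 2 * ?g)\<^sup>2 \<le> exp (- rate * ?g)" .
  qed simp
  ultimately have "(norm (D (Suc n) \<omega>))\<^sup>2 \<le> exp (- rate * ?g) * (norm (D n \<omega>))\<^sup>2 +
      (4 * (1 - 2 * ?g) * ?g * (D n \<omega> \<bullet> noise n \<omega>) + 4 * R\<^sup>2 * ?g\<^sup>2)"
    by (simp add: mult_ac)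
  then have "growth (Suc n) \<omega> * (norm (D (Suc n) \<omega>))\<^sup>2 \<le>
      growth (Suc n) \<omega> * (exp (- rate * ?g) * (norm (D n \<omega>))\<^sup>2 +
        (4 * (1 - 2 * ?g) * ?g * (D n \<omega> \<bullet> noise n \<omega>) + 4 * R\<^sup>2 * ?g\<^sup>2))"
    using growth_pos[of "Suc n" \<omega>] by (intro mult_left_mono) auto
  also have "growth (Suc n) \<omega> * exp (- rate * ?g) = growth n \<omega>"
    by (simp add: growth_Suc exp_minus field_simps)
  then have "growth (Suc n) \<omega> * (exp (- rate * ?g) * (norm (D n \<omega>))\<^sup>2 + y) =
      growth n \<omega> * (norm (D n \<omega>))\<^sup>2 + growth (Suc n) \<omega> * y" for y
    by (metis distrib_left mult.assoc)
  finally show ?thesis .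
qed

text \<open>The cross term of the recursion with \<open>noise n\<close> split off. What remains is
  determined before the samples of time n + 1 are drawn.\<close>

definition weight where
  "weight t n \<omega> = (running t n \<omega> * growth (Suc n) \<omega> * (4 * (1 - 2 * step n \<omega>) * step n \<omega>)) *\<^sub>R D n \<omega>"

text \<open>The discounted contribution of the squared noise. Since the sum of
  \<open>growth (Suc n) * step n\<close> over running times is at most of order
  \<open>exp (rate * t)\<close>, this behaves like a weighted mean of the step sizes.\<close>

definition G where
  "G t \<omega> = exp (- rate * t) * (\<Sum>n<horizon t. running t n \<omega> * growth (Suc n) \<omega> * (step n \<omega>)\<^sup>2)"

text \<open>The bound is stated up to the deterministic \<open>horizon t\<close>, which makes its expectation a finite sum.\<close>

lemma norm_D_hitting_le:
  assumes \<omega>: "\<omega> \<in> space M" and N: "N \<le> horizon t" "\<And>n. n < N \<Longrightarrow> T n \<omega> < t" "t \<le> T N \<omega>"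
  shows "(norm (D N \<omega>))\<^sup>2 \<le> exp (- rate * t) *
      ((norm (D 0 \<omega>))\<^sup>2 + (\<Sum>n<horizon t. weight t n \<omega> \<bullet> noise n \<omega>)) + 4 * R\<^sup>2 * G t \<omega>"
proof -
  let ?f = "\<lambda>n. running t n \<omega> * (growth (Suc n) \<omega> * (4 * (1 - 2 * step n \<omega>) * step n \<omega> *
    (D n \<omega> \<bullet> noise n \<omega>) + 4 * R\<^sup>2 * (step n \<omega>)\<^sup>2))"
  have "growth n \<omega> * (norm (D n \<omega>))\<^sup>2 \<le> (norm (D 0 \<omega>))\<^sup>2 + (\<Sum>i<n. ?f i)" if "n \<le> N" for n
    using that
  proof (induction n)
    case 0
    then show ?case by (simp add: growth_def T_def)
  next
    case (Suc n)
    then have "?f n = growth (Suc n) \<omega> * (4 * (1 - 2 * step n \<omega>) * step n \<omega> *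
        (D n \<omega> \<bullet> noise n \<omega>) + 4 * R\<^sup>2 * (step n \<omega>)\<^sup>2)"
      using N(2)[of n] Suc.prems by (simp only: running_def Suc_le_lessD if_True mult_1)
    with growth_norm_D_Suc_le[OF \<omega>, of n]
    have "growth (Suc n) \<omega> * (norm (D (Suc n) \<omega>))\<^sup>2 \<le> growth n \<omega> * (norm (D n \<omega>))\<^sup>2 + ?f n"
      by (simp only:)
    moreover have "growth n \<omega> * (norm (D n \<omega>))\<^sup>2 \<le> (norm (D 0 \<omega>))\<^sup>2 + (\<Sum>i<n. ?f i)"
      using Suc by (meson Suc_leD)
    ultimately have "growth (Suc n) \<omega> * (norm (D (Suc n) \<omega>))\<^sup>2 \<le>
        (norm (D 0 \<omega>))\<^sup>2 + (\<Sum>i<n. ?f i) + ?f n"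
      by (meson add_right_mono order_trans)
    then show ?case
      by (simp only: sum.lessThan_Suc add.assoc)
  qed
  from this[of N] have 1: "growth N \<omega> * (norm (D N \<omega>))\<^sup>2 \<le> (norm (D 0 \<omega>))\<^sup>2 + (\<Sum>i<N. ?f i)"
    by (simp only: order_refl)
  \<comment> \<open>From \<open>N\<close> on the indicator vanishes, so the sum up to
    \<open>N\<close>, which is random in the application, equals the one up to the deterministic
    \<open>horizon t\<close>.\<close>
  have "T N \<omega> \<le> T n \<omega>" if "N \<le> n" for n
    using step_pos by (intro lift_Suc_mono_le[of "\<lambda>n. T n \<omega>", OF _ that]) (simp add: T_Suc less_imp_le)
  then have "running t n \<omega> = 0" if "N \<le> n" for n
    using N(3) that by (force simp: running_def)
  then have "(\<Sum>i<N. ?f i) = (\<Sum>i<horizon t. ?f i)"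
    using N(1) by (intro sum.mono_neutral_left) auto
  also have "\<dots> = (\<Sum>n<horizon t. weight t n \<omega> \<bullet> noise n \<omega>) +
      4 * R\<^sup>2 * (\<Sum>n<horizon t. running t n \<omega> * growth (Suc n) \<omega> * (step n \<omega>)\<^sup>2)"
    unfolding sum_distrib_left sum.distrib[symmetric]
    by (rule sum.cong[OF refl])
      (simp only: weight_def inner_scaleR_left distrib_left mult.assoc mult.commute mult.left_commute)
  finally have 2: "growth N \<omega> * (norm (D N \<omega>))\<^sup>2 \<le> (norm (D 0 \<omega>))\<^sup>2 +
      (\<Sum>n<horizon t. weight t n \<omega> \<bullet> noise n \<omega>) +
      4 * R\<^sup>2 * (\<Sum>n<horizon t. running t n \<omega> * growth (Suc n) \<omega> * (step n \<omega>)\<^sup>2)"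
    using 1 by (simp only: add.assoc)
  have "1 \<le> exp (- rate * t) * growth N \<omega>"
    using mult_left_mono[OF N(3), of rate] rate_pos
    by (simp add: growth_def mult_exp_exp)
  then have "1 * (norm (D N \<omega>))\<^sup>2 \<le> exp (- rate * t) * growth N \<omega> * (norm (D N \<omega>))\<^sup>2"
    by (rule mult_right_mono) simp
  then have "(norm (D N \<omega>))\<^sup>2 \<le> exp (- rate * t) * (growth N \<omega> * (norm (D N \<omega>))\<^sup>2)"
    by (simp only: mult_1 mult.assoc)
  also note mult_left_mono[OF 2 exp_ge_zero[of "- rate * t"]]
  finally show ?thesis
    by (simp only: G_def distrib_left mult.left_commute[of "exp (- rate * t)"])
qed

text \<open>The noise is a mean of centred samples of time n + 1, and the weight involves none of
  them; so each sample contributes a cross term of mean 0.\<close>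

lemma expectation_weight_noise:
  shows "integrable M (\<lambda>\<omega>. weight t n \<omega> \<bullet> noise n \<omega>)"
    and "expectation (\<lambda>\<omega>. weight t n \<omega> \<bullet> noise n \<omega>) = 0"
proof -
  have W: "weight t n \<in> borel_measurable (without (int (Suc n)) m)" for m
  proof -
    have \<kappa>: "\<kappa> i \<in> measurable (without (int (Suc n)) m) (count_space UNIV)" if "i \<le> n" for i
      using measurable_from_past(1)[OF space_without \<Theta>_0_without, of i "int (Suc n)" m] that
      by (metis X_without int_int_eq le_imp_less_Suc le_trans less_irrefl prod.inject)
    \<comment> \<open>Even \<open>T (Suc n)\<close>, which occurs in \<open>growth (Suc n)\<close>,
      is known at time \<open>n\<close>: its last summand \<open>step n\<close> depends on
      \<open>\<kappa> n\<close> only.\<close>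
    have T: "T i \<in> borel_measurable (without (int (Suc n)) m)" if "i \<le> Suc n" for i
      unfolding T_def[abs_def] step_def
    proof (rule borel_measurable_sum)
      fix j assume "j \<in> {..<i}"
      then have [measurable]: "\<kappa> j \<in> measurable (without (int (Suc n)) m) (count_space UNIV)"
        using that by (intro \<kappa>) auto
      show "(\<lambda>\<omega>. \<nu> (\<kappa> j \<omega>)) \<in> borel_measurable (without (int (Suc n)) m)"
        by measurable
    qed
    note [measurable] = T[OF le_SucI[OF order_refl]] T[OF order_refl] \<Theta>_without[of n m] \<kappa>_without[of n m]
    show ?thesis
      unfolding weight_def[abs_def] running_def growth_def D_def step_def by measurable
  qed
  have int: "integrable M (weight t n)"
  proof (rule Bochner_Integration.integrable_bound)
    show "integrable M (\<lambda>\<omega>. (exp (rate * (t + 1)) * 4) * B \<omega>)" by auto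
    show "weight t n \<in> borel_measurable M" by (rule measurable_withoutD[OF W])
    show "AE \<omega> in M. norm (weight t n \<omega>) \<le> norm ((exp (rate * (t + 1)) * 4) * B \<omega>)"
    proof (rule AE_I2)
      fix \<omega> assume \<omega>: "\<omega> \<in> space M"
      have g: "0 < step n \<omega>" "step n \<omega> < 1"
        using step_pos step_le[of n \<omega>] \<nu>_1 by auto
      then have "\<bar>1 - 2 * step n \<omega>\<bar> * step n \<omega> \<le> 1 * 1"
        by (intro mult_mono) auto
      then have "4 * (\<bar>1 - 2 * step n \<omega>\<bar> * step n \<omega>) \<le> 4 * (1 * 1)"
        by (rule mult_left_mono) simp
      then have "\<bar>4 * (1 - 2 * step n \<omega>) * step n \<omega>\<bar> \<le> 4"
        using g(1) by (simp only: abs_mult abs_numeral abs_of_pos mult.assoc mult_1_right)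
      then have "(running t n \<omega> * growth (Suc n) \<omega>) * \<bar>4 * (1 - 2 * step n \<omega>) * step n \<omega>\<bar> * norm (D n \<omega>)
          \<le> exp (rate * (t + 1)) * 4 * B \<omega>"
        using running_growth_le[of t n \<omega>] norm_D_le[OF \<omega>, of n] by (intro mult_mono) auto
      then show "norm (weight t n \<omega>) \<le> norm ((exp (rate * (t + 1)) * 4) * B \<omega>)"
        using running_growth_le(1)[of t n \<omega>] B_ge(4)[of \<omega>] growth_pos[of "Suc n" \<omega>]
        by (simp add: weight_def abs_mult running_def)
    qed
  qed
  note cross = expectation_cross[OF W int]
  have eq: "weight t n \<omega> \<bullet> noise n \<omega> =
      (1 / real Mb) * (\<Sum>m = 1..Mb. weight t n \<omega> \<bullet> (X (int (Suc n)) (int m) \<omega> - \<mu>))" for \<omega>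
    by (simp only: noise_eq inner_scaleR_right inner_sum_right)
  show "integrable M (\<lambda>\<omega>. weight t n \<omega> \<bullet> noise n \<omega>)"
    unfolding eq using cross(1) by (intro integrable_mult_right Bochner_Integration.integrable_sum)
  show "expectation (\<lambda>\<omega>. weight t n \<omega> \<bullet> noise n \<omega>) = 0"
    unfolding eq using cross by (simp add: Bochner_Integration.integral_sum del: of_nat_Suc)
qed

text \<open>Up to a constant, \<open>growth (Suc n) * step n\<close> is at most the increment of
  \<open>growth\<close>. The other factor \<open>step n\<close> is at most 1 before
  \<open>n0\<close>, where the increments add up to at most \<open>growth n0\<close>, and at most
  \<open>\<epsilon>\<close> afterwards, where they add up to at most
  \<open>exp (rate * (t + 1))\<close>.\<close>

lemma G_le:
  assumes "0 \<le> t" "0 \<le> \<epsilon>" "\<And>n. n0 \<le> n \<Longrightarrow> step n \<omega> \<le> \<epsilon>"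
  shows "G t \<omega> \<le> (1 + rate) / rate * (growth n0 \<omega> * exp (- rate * t) + \<epsilon> * exp rate)"
proof -
  let ?d = "\<lambda>n. running t n \<omega> * (growth (Suc n) \<omega> - growth n \<omega>)"
  have d_nonneg: "0 \<le> ?d n" for n
    using growth_mono by (simp add: running_def)
  have "running t n \<omega> * growth (Suc n) \<omega> * (step n \<omega>)\<^sup>2 \<le>
      (1 + rate) / rate * ((if n < n0 then ?d n else 0) + \<epsilon> * ?d n)" for n
  proof -
    let ?g = "step n \<omega>"
    have g: "0 < ?g" "?g < 1"
      using step_pos step_le[of n \<omega>] \<nu>_1 by auto
    define x where "x = rate * ?g"
    have x: "0 < x" "x \<le> rate"
      using g rate_pos by (auto simp: x_def)
    have "growth (Suc n) \<omega> * x \<le> (1 + rate) * (growth (Suc n) \<omega> - growth n \<omega>)"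
    proof -
      \<comment> \<open>By 1 + x \<le> exp x; rearranged, this compares
        \<open>growth (Suc n)\<close> with the increment of \<open>growth\<close>.\<close>
      have "growth n \<omega> * (1 + x) \<le> growth (Suc n) \<omega>"
        using exp_ge_add_one_self[of x] growth_pos[of n \<omega>] by (simp add: growth_Suc x_def mult.commute)
      then have "growth (Suc n) \<omega> * x \<le> (1 + x) * (growth (Suc n) \<omega> - growth n \<omega>)"
        by (simp add: algebra_simps)
      also have "\<dots> \<le> (1 + rate) * (growth (Suc n) \<omega> - growth n \<omega>)"
        using x growth_mono[of n \<omega>] by (intro mult_right_mono) auto
      finally show ?thesis .
    qed
    then have "growth (Suc n) \<omega> * ?g \<le> (1 + rate) / rate * (growth (Suc n) \<omega> - growth n \<omega>)"
      using rate_pos by (simp add: x_def field_simps)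
    then have *: "running t n \<omega> * growth (Suc n) \<omega> * ?g \<le> (1 + rate) / rate * ?d n"
      by (simp add: running_def)
    have "running t n \<omega> * growth (Suc n) \<omega> * ?g\<^sup>2 \<le> ((1 + rate) / rate * ?d n) * ?g"
      using mult_right_mono[OF *, of ?g] g by (simp add: power2_eq_square mult.assoc)
    also have "\<dots> \<le> ((1 + rate) / rate * ?d n) * ((if n < n0 then 1 else 0) + \<epsilon>)"
      using d_nonneg[of n] rate_pos assms g by (intro mult_left_mono) (auto simp: not_less add_increasing2)
    also have "\<dots> = (1 + rate) / rate * ((if n < n0 then ?d n else 0) + \<epsilon> * ?d n)"
    proof -
      have "K * d * ((if c then 1 else 0) + \<epsilon>) = K * ((if c then d else 0) + \<epsilon> * d)" for K d c
        by (cases c) (simp_all add: distrib_left)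
      then show ?thesis .
    qed
    finally show ?thesis .
  qed
  then have "(\<Sum>n<horizon t. running t n \<omega> * growth (Suc n) \<omega> * (step n \<omega>)\<^sup>2) \<le>
      (\<Sum>n<horizon t. (1 + rate) / rate * ((if n < n0 then ?d n else 0) + \<epsilon> * ?d n))"
    by (rule sum_mono)
  also have "\<dots> = (1 + rate) / rate *
      ((\<Sum>n<horizon t. if n < n0 then ?d n else 0) + \<epsilon> * (\<Sum>n<horizon t. ?d n))"
    by (simp only: sum_distrib_left[symmetric] sum.distrib)
  also have "\<dots> \<le> (1 + rate) / rate * (growth n0 \<omega> + \<epsilon> * exp (rate * (t + 1)))"
  proof (intro mult_left_mono add_mono)
    show "(\<Sum>n<L. if n < n0 then ?d n else 0) \<le> growth n0 \<omega>" for L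
  proof -
    have mono: "growth i \<omega> \<le> growth j \<omega>" if "i \<le> j" for i j
      using that by (rule lift_Suc_mono_le[of "\<lambda>n. growth n \<omega>", OF growth_mono])
    have "(\<Sum>n<L. if n < n0 then ?d n else 0) \<le> growth (min L n0) \<omega>"
    proof (induction L)
      case 0
      then show ?case using growth_pos[of 0 \<omega>] by simp
    next
      case (Suc L)
      then show ?case
        using growth_mono[of L \<omega>] by (cases "L < n0") (auto simp: running_def min_def split: if_splits)
    qed
    also have "\<dots> \<le> growth n0 \<omega>" by (rule mono) simp
    finally show ?thesis .
  qed
    show "(\<Sum>n<L. ?d n) \<le> exp (rate * (t + 1))" for L
  proof -
    \<comment> \<open>The first bound makes the sum telescope while running. The second then follows
      because the last running step overshoots \<open>t\<close> by at most 1.\<close>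
    have "(\<Sum>n<L. ?d n) \<le> growth L \<omega> \<and> (\<Sum>n<L. ?d n) \<le> exp (rate * (t + 1))"
    proof (induction L)
      case 0
      then show ?case using growth_pos[of 0 \<omega>] by simp
    next
      case (Suc L)
      then show ?case
        using growth_mono[of L \<omega>] running_growth_le(2)[of t L \<omega>] by (auto simp: running_def)
    qed
    then show ?thesis ..
  qed
  qed (use rate_pos assms(2) in auto)
  finally have "(\<Sum>n<horizon t. running t n \<omega> * growth (Suc n) \<omega> * (step n \<omega>)\<^sup>2) \<le>
      (1 + rate) / rate * (growth n0 \<omega> + \<epsilon> * exp (rate * (t + 1)))" .
  then have "G t \<omega> \<le> exp (- rate * t) * ((1 + rate) / rate * (growth n0 \<omega> + \<epsilon> * exp (rate * (t + 1))))"
    unfolding G_def by (rule mult_left_mono) simp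
  also have "\<dots> = (1 + rate) / rate * (growth n0 \<omega> * exp (- rate * t) +
      \<epsilon> * (exp (- rate * t) * exp (rate * (t + 1))))"
    by (simp add: distrib_left mult.commute mult.left_commute)
  also have "exp (- rate * t) * exp (rate * (t + 1)) = exp rate"
    by (simp add: mult_exp_exp algebra_simps)
  finally show ?thesis .
qed

lemma G_nonneg: "0 \<le> G t \<omega>"
  unfolding G_def
  by (rule mult_nonneg_nonneg[OF exp_ge_zero sum_nonneg]) (rule mult_nonneg_nonneg[OF running_growth_le(1) zero_le_power2])

lemma G_measurable [measurable]: "G t \<in> borel_measurable M"
  unfolding G_def[abs_def] by measurable

lemma G_bounded: "0 \<le> t \<Longrightarrow> G t \<omega> \<le> (1 + rate) / rate * (1 + exp rate)"
proof -
  assume t: "0 \<le> t"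
  \<comment> \<open>All step sizes are below 1, which allows \<open>n0 = 0\<close> and
    \<open>\<epsilon> = 1\<close>. The resulting constant dominates \<open>G\<close> uniformly in
    time and path.\<close>
  have "G t \<omega> \<le> (1 + rate) / rate * (growth 0 \<omega> * exp (- rate * t) + 1 * exp rate)"
    using step_le \<nu>_1 by (intro G_le t) (auto intro: order_trans[OF step_le less_imp_le])
  also have "\<dots> \<le> (1 + rate) / rate * (1 + exp rate)"
    using rate_pos t by (intro mult_left_mono) (auto simp: growth_def T_def)
  finally show ?thesis .
qed

lemma tendsto_exp_rate: "((\<lambda>t. exp (- rate * t)) \<longlongrightarrow> 0) at_top"
  using rate_pos
  by (intro filterlim_compose[OF exp_at_bot] filterlim_tendsto_neg_mult_at_bot[OF tendsto_const])
    (auto intro: filterlim_ident)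

lemma G_tendsto_0:
  assumes "(\<lambda>n. step n \<omega>) \<longlonglongrightarrow> 0"
  shows "((\<lambda>t. G t \<omega>) \<longlongrightarrow> 0) at_top"
proof (rule order_tendstoI)
  fix e :: real assume "0 < e"
  define K where "K = (1 + rate) / rate"
  \<comment> \<open>The term of \<open>G_le\<close> that does not decay in time becomes e /
    2.\<close>
  define \<epsilon> where "\<epsilon> = e / (2 * K * exp rate)"
  have K: "0 < K" using rate_pos by (simp add: K_def)
  then have \<epsilon>: "0 < \<epsilon>" using \<open>0 < e\<close> by (simp add: \<epsilon>_def)
  obtain n0 where n0: "\<And>n. n0 \<le> n \<Longrightarrow> step n \<omega> < \<epsilon>"
    using order_tendstoD(2)[OF assms \<epsilon>] by (auto simp: eventually_sequentially)
  have "((\<lambda>t. K * (growth n0 \<omega> * exp (- rate * t) + \<epsilon> * exp rate)) \<longlongrightarrow>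
      K * (growth n0 \<omega> * 0 + \<epsilon> * exp rate)) at_top"
    by (intro tendsto_intros tendsto_exp_rate)
  moreover have "K * (growth n0 \<omega> * 0 + \<epsilon> * exp rate) < e"
    using K \<open>0 < e\<close> by (simp add: \<epsilon>_def)
  ultimately have "\<forall>\<^sub>F t in at_top. K * (growth n0 \<omega> * exp (- rate * t) + \<epsilon> * exp rate) < e"
    by (rule order_tendstoD(2))
  then show "\<forall>\<^sub>F t in at_top. G t \<omega> < e"
    using eventually_ge_at_top[of 0]
  proof eventually_elim
    case (elim t)
    then show ?case
      using G_le[of t \<epsilon> n0 \<omega>] n0 \<epsilon> by (force simp: K_def less_imp_le)
  qed
qed (simp add: less_le_trans[OF _ G_nonneg])

lemma expectation_G_tendsto_0: "((\<lambda>t. expectation (G t)) \<longlongrightarrow> 0) at_top"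
proof -
  have "((\<lambda>t. expectation (G t)) \<longlongrightarrow> expectation (\<lambda>_. 0 :: real)) at_top"
  proof (rule integral_dominated_convergence_at_top)
    show "AE \<omega> in M. ((\<lambda>t. G t \<omega>) \<longlongrightarrow> 0) at_top"
      using AE_step_tendsto_0 by eventually_elim (rule G_tendsto_0)
    show "\<forall>\<^sub>F t in at_top. AE \<omega> in M. norm (G t \<omega>) \<le> (1 + rate) / rate * (1 + exp rate)"
      using eventually_ge_at_top[of 0]
      by eventually_elim (auto intro!: AE_I2 simp: abs_of_nonneg[OF G_nonneg] G_bounded simp del: times_divide_eq_left)
  qed auto
  then show ?thesis by simp
qed

text \<open>The squared norm at the hitting time lies below an integrable \<open>Q\<close>, whose
  mean loses all cross terms. The inequality x \<le> \<delta> + x^2 / \<delta> passes from this to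
  the first moment.\<close>

lemma Limsup_norm_D_hitting:
  assumes N: "\<And>t \<omega>. 0 \<le> t \<Longrightarrow> \<omega> \<in> space M \<Longrightarrow> N t \<omega> = Inf {n. t \<le> T n \<omega>}"
  shows "Limsup at_top (\<lambda>t. \<integral>\<^sup>+ \<omega>. ennreal (norm (D (N t \<omega>) \<omega>)) \<partial>M) = 0"
proof -
  \<comment> \<open>The last summand keeps \<open>q t\<close> positive, so that its root can be a
    divisor.\<close>
  define q where "q t = exp (- rate * t) * expectation (\<lambda>\<omega>. (norm (D 0 \<omega>))\<^sup>2) +
    4 * R\<^sup>2 * expectation (G t) + exp (- rate * t)" for t
  have "(q \<longlongrightarrow> 0 * expectation (\<lambda>\<omega>. (norm (D 0 \<omega>))\<^sup>2) + 4 * R\<^sup>2 * 0 + 0) at_top"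
    unfolding q_def[abs_def] by (intro tendsto_intros tendsto_exp_rate expectation_G_tendsto_0)
  then have q_lim: "(q \<longlongrightarrow> 0) at_top" by simp
  have q_pos: "0 < q t" for t
    unfolding q_def using G_nonneg
    by (intro add_nonneg_pos add_nonneg_nonneg mult_nonneg_nonneg Bochner_Integration.integral_nonneg) auto
  have bound: "(\<integral>\<^sup>+ \<omega>. ennreal (norm (D (N t \<omega>) \<omega>)) \<partial>M) \<le> ennreal (2 * sqrt (q t))" if "0 \<le> t" for t
  proof -
    define Q where "Q \<omega> = exp (- rate * t) * ((norm (D 0 \<omega>))\<^sup>2 +
      (\<Sum>n<horizon t. weight t n \<omega> \<bullet> noise n \<omega>)) + 4 * R\<^sup>2 * G t \<omega>" for \<omega>
    have int_G: "integrable M (G t)"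
      using G_bounded[OF that] G_nonneg
      by (intro integrable_const_bound[of _ "(1 + rate) / rate * (1 + exp rate)"]) (auto intro!: AE_I2)
    have int_sum: "integrable M (\<lambda>\<omega>. \<Sum>n<horizon t. weight t n \<omega> \<bullet> noise n \<omega>)"
      using expectation_weight_noise(1) by (rule Bochner_Integration.integrable_sum)
    have int_Q: "integrable M Q"
      unfolding Q_def[abs_def] using int_G int_sum by auto
    have "expectation Q = exp (- rate * t) * (expectation (\<lambda>\<omega>. (norm (D 0 \<omega>))\<^sup>2) +
        (\<Sum>n<horizon t. expectation (\<lambda>\<omega>. weight t n \<omega> \<bullet> noise n \<omega>))) + 4 * R\<^sup>2 * expectation (G t)"
      unfolding Q_def[abs_def] using int_G int_sum expectation_weight_noise(1)
      by (simp add: Bochner_Integration.integral_sum)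
    then have EQ: "expectation Q \<le> q t"
      by (simp add: expectation_weight_noise(2) q_def)
    \<comment> \<open>This choice balances both terms: the mean of \<delta> + Q / \<delta> is then
      at most 2 \<delta>.\<close>
    let ?\<delta> = "sqrt (q t)"
    have D_le: "(norm (D (N t \<omega>) \<omega>))\<^sup>2 \<le> Q \<omega>" if \<omega>: "\<omega> \<in> space M" for \<omega>
      unfolding Q_def
    proof (rule norm_D_hitting_le[OF \<omega>])
      have N_eq: "N t \<omega> = Inf {n. t \<le> T n \<omega>}" by (rule N[OF \<open>0 \<le> t\<close> \<omega>])
      \<comment> \<open>\<open>horizon t\<close> belongs to the set, so the infimum is over a
        nonempty set of naturals and is attained.\<close>
      show "t \<le> T (N t \<omega>) \<omega>"
        using Inf_nat_def1[of "{n. t \<le> T n \<omega>}"] T_horizon[of t \<omega>] unfolding N_eq by auto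
      show "N t \<omega> \<le> horizon t"
        unfolding N_eq using T_horizon by (intro cInf_lower) auto
      show "T n \<omega> < t" if "n < N t \<omega>" for n
        using that cInf_lower[of n "{n. t \<le> T n \<omega>}"] unfolding N_eq by force
    qed
    have "norm (D (N t \<omega>) \<omega>) \<le> ?\<delta> + Q \<omega> / ?\<delta>" if \<omega>: "\<omega> \<in> space M" for \<omega>
    proof -
      let ?x = "norm (D (N t \<omega>) \<omega>)"
      have "?x * ?\<delta> \<le> ?\<delta>\<^sup>2 + ?x\<^sup>2"
        using sum_squares_bound[of ?x ?\<delta>] mult_nonneg_nonneg[OF norm_ge_zero real_sqrt_ge_zero, of "q t" "D (N t \<omega>) \<omega>"]
          q_pos[of t] by linarith
      also have "\<dots> \<le> ?\<delta>\<^sup>2 + Q \<omega>"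
        using D_le[OF \<omega>] by simp
      finally show ?thesis
        using q_pos[of t] by (simp add: field_simps power2_eq_square)
    qed
    then have "(\<integral>\<^sup>+ \<omega>. ennreal (norm (D (N t \<omega>) \<omega>)) \<partial>M) \<le> (\<integral>\<^sup>+ \<omega>. ennreal (?\<delta> + Q \<omega> / ?\<delta>) \<partial>M)"
      by (intro nn_integral_mono ennreal_leI)
    also have "\<dots> = ennreal (expectation (\<lambda>\<omega>. ?\<delta> + Q \<omega> / ?\<delta>))"
      using int_Q q_pos[of t] D_le
      by (intro nn_integral_eq_integral) (auto intro!: AE_I2 add_nonneg_nonneg divide_nonneg_nonneg intro: order_trans[OF zero_le_power2])
    also have "expectation (\<lambda>\<omega>. ?\<delta> + Q \<omega> / ?\<delta>) = ?\<delta> + expectation Q / ?\<delta>"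
      using int_Q by (simp add: prob_space)
    also have "\<dots> \<le> ?\<delta> + q t / ?\<delta>"
      using EQ q_pos[of t] by (intro add_left_mono divide_right_mono) auto
    also have "\<dots> = 2 * ?\<delta>"
      using q_pos[of t] by (simp add: real_div_sqrt)
    finally show ?thesis
      by (simp add: ennreal_leI)
  qed
  have "\<forall>\<^sub>F t in at_top. (\<integral>\<^sup>+ \<omega>. ennreal (norm (D (N t \<omega>) \<omega>)) \<partial>M) \<le> ennreal (2 * sqrt (q t))"
    using eventually_ge_at_top[of 0] by eventually_elim (rule bound)
  then have "Limsup at_top (\<lambda>t. \<integral>\<^sup>+ \<omega>. ennreal (norm (D (N t \<omega>) \<omega>)) \<partial>M) \<le>
      Limsup at_top (\<lambda>t. ennreal (2 * sqrt (q t)))"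
    by (rule Limsup_mono)
  also have "((\<lambda>t. ennreal (2 * sqrt (q t))) \<longlongrightarrow> ennreal (2 * sqrt 0)) at_top"
    by (intro tendsto_ennrealI tendsto_mult tendsto_const tendsto_real_sqrt q_lim)
  then have "Limsup at_top (\<lambda>t. ennreal (2 * sqrt (q t))) = 0"
    by (intro lim_imp_Limsup) auto
  finally show ?thesis by simp
qed

end

section \<open>From the adaptive scheme to the stated convergence\<close>

theorem theorem1p1:
  fixes M :: "'w measure"
    and X :: "int \<Rightarrow> int \<Rightarrow> 'w \<Rightarrow> real ^ 'd"
    and a b :: real
    and l :: "real ^ 'd \<Rightarrow> real ^ 'd \<Rightarrow> real"
    and Mb Mf :: nat
    and \<Theta> :: "nat \<Rightarrow> 'w \<Rightarrow> real ^ 'd"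
    and \<gamma> :: "nat \<Rightarrow> 'w \<Rightarrow> real"
    and \<nu> :: "nat \<Rightarrow> real"
    and N :: "real \<Rightarrow> 'w \<Rightarrow> nat"
  assumes "a < b"
    and P: "prob_space M"
    and X_meas: "\<And>n m. X n m \<in> borel_measurable M"
    and X_range: "\<And>n m \<omega> i. \<omega> \<in> space M \<Longrightarrow> a \<le> X n m \<omega> $ i \<and> X n m \<omega> $ i \<le> b"
    and X_indep: "prob_space.indep_vars M (\<lambda>_. borel) (\<lambda>p. X (fst p) (snd p)) UNIV"
    and X_ident: "\<And>n m. distr M borel (X n m) = distr M borel (X 0 0)"
    and X_supp: "\<And>x \<epsilon>. (\<forall>i. a \<le> x $ i \<and> x $ i \<le> b) \<Longrightarrow> 0 < \<epsilon> \<Longrightarrow> \<epsilon> < 1 \<Longrightarrow>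
        measure M {\<omega> \<in> space M. norm (X 0 0 \<omega> - x) < \<epsilon>} > 0"
    and l_def: "\<And>\<theta> x. l \<theta> x = (norm (\<theta> - x))\<^sup>2"
    and "Mb \<ge> 1" and "Mf \<ge> 1"
    and \<Theta>_meas: "\<And>n. \<Theta> n \<in> borel_measurable M"
    and \<gamma>_meas: "\<And>n. n \<ge> 1 \<Longrightarrow> \<gamma> n \<in> borel_measurable M"
    and \<Theta>_rec: "\<And>n \<omega>. n \<ge> 1 \<Longrightarrow> \<omega> \<in> space M \<Longrightarrow>
        \<Theta> n \<omega> = \<Theta> (n - 1) \<omega> - (\<gamma> n \<omega> / real Mb) *\<^sub>R
          (\<Sum>m = 1..Mb. grad1 l (\<Theta> (n - 1) \<omega>) (X (int n) (int m) \<omega>))"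
    and indep_X_\<Theta>0: "prob_space.indep_set M
        (sigma_sets (space M) (\<Union>p. {X (fst p) (snd p) -` A \<inter> space M | A. A \<in> sets borel}))
        (sigma_sets (space M) {\<Theta> 0 -` A \<inter> space M | A. A \<in> sets borel})"
    and \<Theta>0_L2: "integrable M (\<lambda>\<omega>. (norm (\<Theta> 0 \<omega>))\<^sup>2)"
    and \<nu>_range: "\<And>n. n \<ge> 1 \<Longrightarrow> 0 < \<nu> n \<and> \<nu> n < 1"
    and \<nu>_decr: "\<And>n k. 1 \<le> n \<Longrightarrow> n < k \<Longrightarrow> \<nu> k < \<nu> n"
    and \<nu>_div: "filterlim (\<lambda>K. \<Sum>n = 1..K. \<nu> n) at_top sequentially"
    and \<nu>_limsup: "limsup (\<lambda>n. ereal (\<nu> n)) = 0"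
    and \<gamma>1: "\<And>\<omega>. \<omega> \<in> space M \<Longrightarrow> \<gamma> 1 \<omega> = \<nu> 1"
    and \<gamma>_rec: "\<And>n \<omega>. n \<ge> 1 \<Longrightarrow> \<omega> \<in> space M \<Longrightarrow>
        \<gamma> (Suc n) \<omega> =
          (if (\<Sum>m = 1..Mf. l (\<Theta> n \<omega>) (X (int n) (- int m) \<omega>))
                \<le> (\<Sum>m = 1..Mf. l (\<Theta> (n - 1) \<omega>) (X (int n) (- int m) \<omega>))
           then \<gamma> n \<omega>
           else (GREATEST y. y \<in> {0<..<\<gamma> n \<omega>} \<inter> {\<nu> k | k. k \<ge> 1}))"
    and N_def: "\<And>t \<omega>. 0 \<le> t \<Longrightarrow> N t \<omega> = Inf {n. (\<Sum>k = 1..n. \<gamma> k \<omega>) \<ge> t}"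
  shows "Limsup at_top (\<lambda>t. \<integral>\<^sup>+ \<omega>. ennreal (norm (\<Theta> (N t \<omega>) \<omega> - integral\<^sup>L M (X 1 1))) \<partial>M) = 0"
proof -
  interpret prob_space M by (rule P)
  have l: "l = (\<lambda>\<theta> x. (norm (\<theta> - x))\<^sup>2)"
    using l_def by blast
  interpret adaptive_sgd M X a b Mb Mf \<Theta> \<gamma> \<nu>
  proof
    show "\<Theta> (Suc n) \<omega> = \<Theta> n \<omega> - (2 * \<gamma> (Suc n) \<omega>) *\<^sub>R
        (\<Theta> n \<omega> - (1 / real Mb) *\<^sub>R (\<Sum>m = 1..Mb. X (int (Suc n)) (int m) \<omega>))"
      if "\<omega> \<in> space M" for n \<omega>
    proof -
      \<comment> \<open>Each gradient is twice the difference of state and sample, so the batch size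
        cancels and the batch mean appears.\<close>
      have "(\<Sum>m = 1..Mb. grad1 l (\<Theta> n \<omega>) (X (int (Suc n)) (int m) \<omega>)) =
          (2 * real Mb) *\<^sub>R (\<Theta> n \<omega> - (1 / real Mb) *\<^sub>R (\<Sum>m = 1..Mb. X (int (Suc n)) (int m) \<omega>))"
        using \<open>1 \<le> Mb\<close>
        by (simp add: grad1_squared_dist[OF l_def] scaleR_sum_right[symmetric] sum_subtractf
            sum_constant_scaleR scaleR_right_diff_distrib mult.commute del: sum_constant of_nat_Suc)
      then show ?thesis
        using \<Theta>_rec[of "Suc n" \<omega>] that \<open>1 \<le> Mb\<close> by (simp del: of_nat_Suc)
    qed
    show "\<nu> \<longlonglongrightarrow> 0"
    proof -
      have "(\<lambda>n. ereal (\<nu> n)) \<longlonglongrightarrow> 0"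
      proof (rule Liminf_eq_Limsup[OF sequentially_bot])
        show "limsup (\<lambda>n. ereal (\<nu> n)) = 0" by (rule \<nu>_limsup)
        \<comment> \<open>Positivity of \<open>\<nu>\<close> turns the vanishing limsup into a
          limit.\<close>
        have "0 \<le> liminf (\<lambda>n. ereal (\<nu> n))"
          using \<nu>_range by (intro Liminf_bounded eventually_sequentiallyI[of 1]) (auto simp: less_imp_le)
        moreover have "liminf (\<lambda>n. ereal (\<nu> n)) \<le> limsup (\<lambda>n. ereal (\<nu> n))"
          by (rule Liminf_le_Limsup) simp
        ultimately show "liminf (\<lambda>n. ereal (\<nu> n)) = 0"
          using \<nu>_limsup by simp
      qed
      then show ?thesis
        by (simp add: zero_ereal_def)
    qed
    show "\<gamma> (Suc (Suc n)) \<omega> =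
          (if (\<Sum>m = 1..Mf. (norm (\<Theta> (Suc n) \<omega> - X (int (Suc n)) (- int m) \<omega>))\<^sup>2)
                \<le> (\<Sum>m = 1..Mf. (norm (\<Theta> n \<omega> - X (int (Suc n)) (- int m) \<omega>))\<^sup>2)
           then \<gamma> (Suc n) \<omega>
           else (GREATEST y. y \<in> {0<..<\<gamma> (Suc n) \<omega>} \<inter> {\<nu> k | k. k \<ge> 1}))"
      if "\<omega> \<in> space M" for n \<omega>
      using \<gamma>_rec[of "Suc n" \<omega>] that unfolding l by simp
  qed (fact assms)+
  \<comment> \<open>An index shift: \<open>\<gamma>\<close> starts at 1 and \<open>step\<close> at
    0.\<close>
  have "(\<Sum>k = 1..n. \<gamma> k \<omega>) = T n \<omega>" if "\<omega> \<in> space M" for n \<omega>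
    unfolding T_def \<gamma>_eq_step[OF that, symmetric]
    by (intro sum.reindex_bij_witness[of _ Suc "\<lambda>i. i - 1"]) auto
  then have "N t \<omega> = Inf {n. t \<le> T n \<omega>}" if "0 \<le> t" "\<omega> \<in> space M" for t \<omega>
    using N_def[OF that(1)] that(2) by simp
  from Limsup_norm_D_hitting[OF this] show ?thesis
    by (simp add: D_def \<mu>_def)
qed

end
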